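(* Let $d\in\mathbb{Z}^+$, $M=\mathbb{R}^d$ with Euclidean norm $\lVert\cdot\rVert$, $\xi\in\mathbb{Z}^+$, $\Xi=\{1,\ldots,\xi\}$, and let $(Y,S)$ and $(Y_i,S_i)$, $i\in\mathbb{Z}^+$, be $\mathbb{R}^d\times\Xi$-valued random elements on a probability space $(\Omega,\mathcal{F},P)$. For $n\in\mathbb{Z}^+$ and $s\in\Xi$ put $N_n^s=\sum_{i=1}^n I\{S_i=s\}$. Assume: (i) the pairs $(Y_i,S_i)$, $i\in\mathbb{Z}^+$, are independent; (ii) for every $i\in\mathbb{Z}^+$ and every $s\in\Xi$ with $P(S_i=s)P(S=s)>0$, the conditional distribution of $Y_i$ given $S_i=s$ equals the conditional distribution of $Y$ given $S=s$; (iii) $\lim_{n\to\infty}N_n^s=\infty$ almost surely for every $s\in\Xi$; (iv) $P(S=s)>0$ for every $s\in\Xi$. Suppose $E(\lVert Y\rVert\mid S=s)<\infty$ for all $s\in\Xi$. For each $n\in\mathbb{Z}^+$ let $\hat\lambda_n^s$ ($s\in\Xi$) be $[0,1]$-valued random variables on $(\Omega,\mathcal{F},P)$ with $\sum_{s=1}^\xi\hat\lambda_n^s=1$, and let $$\hat\mu_n=\sum_{s=1}^\xi\hat\lambda_n^s\,\hat\mu^s_{N_n^s},$$ where $\hat\mu_m^s=\frac1m\sum_{j=1}^m Y_{(j)}^s$ for $m\in\mathbb{Z}^+$ and $Y_{(j)}^s$ is the variable of interest for the $j$th sampled unit from group $s$ (defined in the context). If $\hat\lambda_n^s\to P(S=s)$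 almost surely as $n\to\infty$ for all $s\in\Xi$, then $\hat\mu_n\to E(Y)$ almost surely as $n\to\infty$. Likewise, if $\hat\lambda_n^s\to P(S=s)$ in probability as $n\to\infty$ for all $s\in\Xi$, then $\hat\mu_n\to E(Y)$ in probability as $n\to\infty$.
   Context: $I\{\cdot\}$ denotes an indicator function; $\Xi$ carries its discrete $\sigma$-algebra. For $s\in\Xi$ let $\Omega^s=\{\lim_{n\to\infty}N_n^s=\infty\}$. For $s\in\Xi$ and $j\in\mathbb{Z}^+$ define $K_j^s:\Omega\to\mathbb{Z}^+$ as follows: on $\Omega^s$, $K_j^s$ is the smallest $k\in\mathbb{Z}^+$ with $\sum_{i=1}^k I\{S_i=s\}=j$; on $(\Omega^s)^c$, $K_j^s=1$. Then $Y_{(j)}^s=Y_{K_j^s}$. The random variables $\hat\lambda_n^s$ are not assumed to be independent of the data. Convention: $\hat\mu_0^s=0$ (relevant only when $N_n^s=0$). *)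

theory Defs
  imports "HOL-Probability.Probability"
begin

text \<open>
  All sequences are indexed by \<open>nat\<close>, but only the indices \<open>\<ge> 1\<close> carry meaning; the group labels
  are the numbers \<open>1, \<dots>, \<xi>\<close>. Throughout, \<open>Ys i \<omega>\<close> and \<open>Ss i \<omega>\<close> are the variable of interest and
  the group of the \<open>i\<close>th sampled unit.
\<close>

definition cond_measure :: "'w measure \<Rightarrow> ('w \<Rightarrow> nat) \<Rightarrow> nat \<Rightarrow> 'w measure" where
  \<comment> \<open>The measure \<open>P(\<cdot> | T = s)\<close>, i.e. \<open>A \<mapsto> P(A \<inter> {T = s}) / P(T = s)\<close>; only meaningful if
    \<open>P(T = s) > 0\<close>.\<close>
  "cond_measure P T s = uniform_measure P {\<omega> \<in> space P. T \<omega> = s}"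

definition group_count :: "(nat \<Rightarrow> 'w \<Rightarrow> nat) \<Rightarrow> nat \<Rightarrow> nat \<Rightarrow> 'w \<Rightarrow> nat" where
  "group_count Ss s n \<omega> = (\<Sum>i=1..n. of_bool (Ss i \<omega> = s))"

definition group_index :: "(nat \<Rightarrow> 'w \<Rightarrow> nat) \<Rightarrow> nat \<Rightarrow> nat \<Rightarrow> 'w \<Rightarrow> nat" where
  "group_index Ss s j \<omega> =
     (if filterlim (\<lambda>n. group_count Ss s n \<omega>) at_top sequentially
      then (LEAST k. 1 \<le> k \<and> group_count Ss s k \<omega> = j)
      else 1)"

definition group_obs ::
  "(nat \<Rightarrow> 'w \<Rightarrow> 'a) \<Rightarrow> (nat \<Rightarrow> 'w \<Rightarrow> nat) \<Rightarrow> nat \<Rightarrow> nat \<Rightarrow> 'w \<Rightarrow> 'a" where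
  "group_obs Ys Ss s j \<omega> = Ys (group_index Ss s j \<omega>) \<omega>"

definition group_mean ::
  "(nat \<Rightarrow> 'w \<Rightarrow> 'a::real_vector) \<Rightarrow> (nat \<Rightarrow> 'w \<Rightarrow> nat) \<Rightarrow> nat \<Rightarrow> nat \<Rightarrow> 'w \<Rightarrow> 'a" where
  \<comment> \<open>For \<open>m = 0\<close> the sum is empty, so the mean is \<open>0\<close>.\<close>
  "group_mean Ys Ss s m \<omega> = (1 / real m) *\<^sub>R (\<Sum>j=1..m. group_obs Ys Ss s j \<omega>)"

definition weighted_mean ::
  "nat \<Rightarrow> (nat \<Rightarrow> nat \<Rightarrow> 'w \<Rightarrow> real) \<Rightarrow> (nat \<Rightarrow> 'w \<Rightarrow> 'a::real_vector) \<Rightarrow> (nat \<Rightarrow> 'w \<Rightarrow> nat)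
    \<Rightarrow> nat \<Rightarrow> 'w \<Rightarrow> 'a" where
  "weighted_mean \<xi> lam Ys Ss n \<omega> =
     (\<Sum>s=1..\<xi>. lam n s \<omega> *\<^sub>R group_mean Ys Ss s (group_count Ss s n \<omega>) \<omega>)"

definition tendsto_in_prob ::
  "'w measure \<Rightarrow> (nat \<Rightarrow> 'w \<Rightarrow> 'a::metric_space) \<Rightarrow> 'a \<Rightarrow> bool" where
  \<comment> \<open>Convergence in probability to a constant. As \<open>measure\<close> vanishes on non-measurable sets, this is
    to be used only for sequences whose terms \<open>X n\<close>, \<open>n \<ge> 1\<close>, are random variables.\<close>
  "tendsto_in_prob P X c \<longleftrightarrow>
     (\<forall>\<epsilon>>0. (\<lambda>n. measure P {\<omega> \<in> space P. dist (X n \<omega>) c > \<epsilon>}) \<longlonglongrightarrow> 0)"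

end

theory Submission
  imports Defs
begin

text \<open>
  Once \<open>N\<^sub>n\<^sup>s \<rightarrow> \<infinity>\<close>, the group mean \<open>\<mu>\<^sup>s\<close> at \<open>N\<^sub>n\<^sup>s\<close> is the ratio of \<open>\<Sum>i\<le>n. I{S\<^sub>i = s} Y\<^sub>i\<close> and
  \<open>N\<^sub>n\<^sup>s = \<Sum>i\<le>n. I{S\<^sub>i = s}\<close>, so the joint law of the random subsequence \<open>Y\<^sub>(\<^sub>j\<^sub>)\<^sup>s\<close> is never needed. Both
  sums have independent terms \<open>I{S\<^sub>i = s} f(Y\<^sub>i)\<close> that differ only in \<open>p\<^sub>i = P(S\<^sub>i = s)\<close>, and
  \<open>b\<^sub>n = 1 + \<Sum>i\<le>n. p\<^sub>i\<close> tends to infinity by the Borel-Cantelli lemma. A strong law with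
  normalisation \<open>b\<^sub>n\<close>, applied to \<open>f = 1\<close> and to the positive and negative parts of the coordinates,
  shows that the ratio tends to \<open>E(Y | S = s)\<close> almost surely. The weights \<open>\<lambda>\<close> then enter only through
  limits of finite sums, or through a union bound for convergence in probability.
\<close>

section \<open>Interpolation and summation inequalities for real sequences\<close>

text \<open>The indices at which \<open>b\<close> first reaches the powers of a fixed ratio
  \<open>al j\<close> cut the time axis into blocks on which \<open>b\<close> varies by a factor of
  about \<open>al j\<close>. Monotonicity of \<open>T\<close> traps \<open>T n / b n\<close> between
  neighbouring values on the subsequence, up to that factor, which tends to 1 as \<open>j\<close>
  grows.\<close>

lemma tendsto_ratio_of_geometric_subsequences:
  fixes T b :: "nat \<Rightarrow> real"
  assumes T_nonneg: "\<And>n. 0 \<le> T n" and T_mono: "mono T" and b_mono: "mono b" and b_0: "b 0 = 1"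
    and b_Suc: "\<And>n. b (Suc n) \<le> b n + 1" and b_lim: "filterlim b at_top sequentially"
    and lim: "\<And>j. (\<lambda>k. T (LEAST n. (1 + 1 / real (Suc j)) ^ k \<le> b n) /
                     b (LEAST n. (1 + 1 / real (Suc j)) ^ k \<le> b n)) \<longlonglongrightarrow> m"
  shows "(\<lambda>n. T n / b n) \<longlonglongrightarrow> m"
proof -
  define al where "al j = 1 + 1 / real (Suc j)" for j
  define \<nu> where "\<nu> j k = (LEAST n. al j ^ k \<le> b n)" for j k
  define R where "R j k = T (\<nu> j k) / b (\<nu> j k)" for j k
  have al: "al j > 1" for j by (simp add: al_def)
  have R: "R j \<longlonglongrightarrow> m" for j using lim[of j] by (simp add: R_def[abs_def] \<nu>_def al_def)
  have b_ge: "1 \<le> b n" for n using monoD[OF b_mono, of 0 n] b_0 by simp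
  have ex: "\<exists>n. x \<le> b n" for x
    using b_lim unfolding filterlim_at_top by (metis eventually_sequentially order_refl)
  have \<nu>_ge: "al j ^ k \<le> b (\<nu> j k)" for j k
    unfolding \<nu>_def by (rule LeastI_ex[OF ex])
  \<comment> \<open>Increments of \<open>b\<close> are at most 1, so \<open>b\<close> overshoots a
    power by at most 1 when it first reaches it.\<close>
  have \<nu>_le: "b (\<nu> j k) \<le> al j ^ k + 1" for j k
  proof (cases "\<nu> j k")
    case 0
    then show ?thesis using b_0 al[of j] by simp
  next
    case (Suc n)
    then have "\<not> al j ^ k \<le> b n" unfolding \<nu>_def by (intro not_less_Least) simp
    with b_Suc[of n] Suc show ?thesis by simp
  qed
  \<comment> \<open>\<open>\<kappa> j n\<close> is the block of \<open>n\<close>: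
    \<open>al j ^ \<kappa> j n \<le> b n < al j ^ Suc (\<kappa> j n)\<close>, so \<open>n\<close>
    lies between \<open>\<nu> j (\<kappa> j n)\<close> and
    \<open>\<nu> j (Suc (\<kappa> j n))\<close>.\<close>
  define \<kappa> where "\<kappa> j n = (LEAST k. b n < al j ^ Suc k)" for j n
  have ex_pow: "\<exists>k. b n < al j ^ Suc k" for j n
  proof -
    obtain k where "b n < al j ^ k" using real_arch_pow[OF al] by blast
    also have "\<dots> \<le> al j ^ Suc k" using al[of j] by (intro power_increasing) auto
    finally show ?thesis by blast
  qed
  have \<kappa>_less: "b n < al j ^ Suc (\<kappa> j n)" for j n
    unfolding \<kappa>_def by (rule LeastI_ex[OF ex_pow])
  have \<kappa>_ge: "al j ^ \<kappa> j n \<le> b n" for j n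
  proof (cases "\<kappa> j n")
    case 0
    then show ?thesis using b_ge by simp
  next
    case (Suc k)
    then have "\<not> b n < al j ^ Suc k" unfolding \<kappa>_def by (intro not_less_Least) simp
    with Suc show ?thesis by simp
  qed
  have \<kappa>_lim: "filterlim (\<kappa> j) at_top sequentially" for j
    unfolding filterlim_at_top
  proof
    fix K
    have "\<forall>\<^sub>F n in sequentially. al j ^ K \<le> b n" using b_lim by (simp add: filterlim_at_top)
    then show "\<forall>\<^sub>F n in sequentially. K \<le> \<kappa> j n"
    proof eventually_elim
      case (elim n)
      show ?case
      proof (rule ccontr)
        assume "\<not> K \<le> \<kappa> j n"
        then have "al j ^ Suc (\<kappa> j n) \<le> al j ^ K" using al[of j] by (intro power_increasing) auto
        with elim \<kappa>_less[of n j] show False by simp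
      qed
    qed
  qed
  have R_nonneg: "0 \<le> R j k" for j k
    unfolding R_def using T_nonneg b_ge[of "\<nu> j k"] by simp
  have T_\<nu>: "T (\<nu> j k) = R j k * b (\<nu> j k)" for j k
    unfolding R_def using b_ge[of "\<nu> j k"] by simp
  have lower: "R j (\<kappa> j n) / al j \<le> T n / b n" for j n
  proof -
    have "\<nu> j (\<kappa> j n) \<le> n" unfolding \<nu>_def by (rule Least_le) (rule \<kappa>_ge)
    then have "R j (\<kappa> j n) * b (\<nu> j (\<kappa> j n)) \<le> T n" using monoD[OF T_mono] T_\<nu> by metis
    moreover have "R j (\<kappa> j n) * al j ^ \<kappa> j n \<le> R j (\<kappa> j n) * b (\<nu> j (\<kappa> j n))"
      by (intro mult_left_mono \<nu>_ge R_nonneg)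
    ultimately have 1: "R j (\<kappa> j n) * al j ^ \<kappa> j n \<le> T n" by simp
    have "R j (\<kappa> j n) / al j = (R j (\<kappa> j n) * al j ^ \<kappa> j n) / al j ^ Suc (\<kappa> j n)"
      using al[of j] by simp
    also have "\<dots> \<le> T n / b n"
      using 1 \<kappa>_less[of n j] b_ge[of n] T_nonneg[of n] by (intro frac_le) auto
    finally show ?thesis .
  qed
  \<comment> \<open>The term \<open>(1 / al j) ^ \<kappa> j n\<close> is the overshoot 1 from
    \<open>\<nu>_le\<close> divided by the lower bound for \<open>b n\<close>; it vanishes in the
    limit.\<close>
  have upper: "T n / b n \<le> R j (Suc (\<kappa> j n)) * (al j + (1 / al j) ^ \<kappa> j n)" for j n
  proof -
    let ?k = "\<kappa> j n"
    have "n \<le> \<nu> j (Suc ?k)"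
    proof (rule ccontr)
      assume "\<not> ?thesis"
      then have "b (\<nu> j (Suc ?k)) \<le> b n" using monoD[OF b_mono] by simp
      with \<nu>_ge[of j "Suc ?k"] \<kappa>_less[of n j] show False by simp
    qed
    then have "T n \<le> R j (Suc ?k) * b (\<nu> j (Suc ?k))" using monoD[OF T_mono] T_\<nu> by metis
    also have "\<dots> \<le> R j (Suc ?k) * (al j ^ Suc ?k + 1)"
      by (intro mult_left_mono \<nu>_le R_nonneg)
    finally have "T n / b n \<le> R j (Suc ?k) * (al j ^ Suc ?k + 1) / al j ^ ?k"
      using \<kappa>_ge[of j n] al[of j] R_nonneg by (intro frac_le) auto
    also have "\<dots> = R j (Suc ?k) * (al j + (1 / al j) ^ ?k)"
      using al[of j] by (simp add: field_simps power_divide)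
    finally show ?thesis .
  qed
  have low_lim: "(\<lambda>n. R j (\<kappa> j n) / al j) \<longlonglongrightarrow> m / al j" for j
    using al[of j] by (intro tendsto_divide filterlim_compose[OF R \<kappa>_lim] tendsto_const) auto
  have up_lim: "(\<lambda>n. R j (Suc (\<kappa> j n)) * (al j + (1 / al j) ^ \<kappa> j n)) \<longlonglongrightarrow> m * (al j + 0)" for j
    using al[of j]
    by (intro tendsto_intros filterlim_compose[OF LIMSEQ_Suc[OF R] \<kappa>_lim]
        filterlim_compose[OF LIMSEQ_power_zero \<kappa>_lim]) (auto simp: field_simps)
  have al_lim: "al \<longlonglongrightarrow> 1"
    unfolding al_def[abs_def] using tendsto_add[OF tendsto_const LIMSEQ_Suc[OF lim_1_over_n]] by simp
  \<comment> \<open>For fixed \<open>j\<close> the two bounds tend to \<open>m / al j\<close> and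
    \<open>m * al j\<close>. First \<open>j\<close> is chosen so that the relevant one is on the
    correct side of \<open>a\<close>, then \<open>n\<close> tends to infinity.\<close>
  show ?thesis
  proof (rule order_tendstoI)
    fix a assume "a < m"
    have "(\<lambda>j. m / al j) \<longlonglongrightarrow> m / 1" by (intro tendsto_intros al_lim) auto
    then have "\<forall>\<^sub>F j in sequentially. a < m / al j" using \<open>a < m\<close> by (intro order_tendstoD) auto
    then obtain j where "a < m / al j" by (auto simp: eventually_sequentially)
    from order_tendstoD(1)[OF low_lim this]
    show "\<forall>\<^sub>F n in sequentially. a < T n / b n"
      by eventually_elim (rule less_le_trans[OF _ lower])
  next
    fix a assume "m < a"
    have "(\<lambda>j. m * (al j + 0)) \<longlonglongrightarrow> m * (1 + 0)" by (intro tendsto_intros al_lim)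
    then have "\<forall>\<^sub>F j in sequentially. m * (al j + 0) < a" using \<open>m < a\<close> by (intro order_tendstoD) auto
    then obtain j where "m * (al j + 0) < a" by (auto simp: eventually_sequentially)
    from order_tendstoD(2)[OF up_lim this]
    show "\<forall>\<^sub>F n in sequentially. T n / b n < a"
      by eventually_elim (rule le_less_trans[OF upper])
  qed
qed

text \<open>A retained term satisfies \<open>(1 - r) * r ^ k = r ^ k - r ^ Suc k\<close>, which is
  the decrease of \<open>min (r ^ k) y\<close>. These decreases telescope to at most
  \<open>y\<close>, whatever \<open>K\<close> is.\<close>

lemma geometric_sum_le_inverse:
  fixes r y :: real
  assumes "0 < r" "r < 1" "0 \<le> y"
  shows "(\<Sum>k<K. if r ^ k \<le> y then r ^ k else 0) \<le> y / (1 - r)"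
proof -
  have "(1 - r) * (if r ^ k \<le> y then r ^ k else 0) \<le> min (r ^ k) y - min (r ^ Suc k) y" for k
  proof -
    have "r ^ Suc k \<le> r ^ k" using assms by (simp add: mult_left_le_one_le)
    then show ?thesis by (auto simp: min_def algebra_simps)
  qed
  then have "(\<Sum>k<K. (1 - r) * (if r ^ k \<le> y then r ^ k else 0))
      \<le> (\<Sum>k<K. min (r ^ k) y - min (r ^ Suc k) y)"
    by (intro sum_mono)
  also have "\<dots> = min (r ^ 0) y - min (r ^ K) y"
    by (rule sum_lessThan_telescope')
  also have "\<dots> \<le> y" using assms(3) zero_less_power[OF assms(1), of K] by simp
  finally have "(1 - r) * (\<Sum>k<K. if r ^ k \<le> y then r ^ k else 0) \<le> y"
    unfolding sum_distrib_left .
  then show ?thesis using assms by (simp add: field_simps)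
qed

text \<open>As \<open>p i\<close> is the increment of \<open>b\<close>, both sums are discrete
  integrals in \<open>b\<close>: of 1 over the range below \<open>x\<close>, and of
  \<open>x\<^sup>2 / t\<^sup>2\<close> over the range above \<open>x\<close>. The first controls
  what truncation removes, the second the second moments of what it keeps.\<close>

lemma truncation_sums:
  fixes p b :: "nat \<Rightarrow> real"
  assumes p: "\<And>i. 0 \<le> p i" "\<And>i. p i \<le> 1" and b_0: "b 0 = 1" and b_Suc: "\<And>i. b (Suc i) = b i + p i"
    and x: "0 \<le> x"
  shows "(\<Sum>i<n. if b (Suc i) < x then p i else 0) \<le> min x (b n)"
    and "(\<Sum>i<n. if x \<le> b (Suc i) then p i * x\<^sup>2 / (b (Suc i))\<^sup>2 else 0) \<le> 2 * x"
proof -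
  have "(\<Sum>i<n. if b (Suc i) < x then p i else 0) \<le> (\<Sum>i<n. min x (b (Suc i)) - min x (b i))"
    using p by (intro sum_mono) (auto simp: b_Suc min_def)
  also have "\<dots> = min x (b n) - min x (b 0)" by (rule sum_lessThan_telescope)
  also have "\<dots> \<le> min x (b n)" using x b_0 by linarith
  finally show "(\<Sum>i<n. if b (Suc i) < x then p i else 0) \<le> min x (b n)" .
next
  have b_ge: "1 \<le> b i" for i by (induction i) (use b_0 b_Suc p in \<open>auto intro: order_trans\<close>)
  show "(\<Sum>i<n. if x \<le> b (Suc i) then p i * x\<^sup>2 / (b (Suc i))\<^sup>2 else 0) \<le> 2 * x"
  proof (cases "x = 0")
    case False
    with x have x: "0 < x" by simp
    \<comment> \<open>The cutoff \<open>x / 2\<close> works because \<open>x \<le> b (Suc i)\<close> forces \<open>b i \<ge> max 1 (x - 1) \<ge> x / 2\<close>.\<close>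
    define \<phi> where "\<phi> i = x\<^sup>2 / max (b i) (x / 2)" for i
    have \<phi>: "(if x \<le> b (Suc i) then p i * x\<^sup>2 / (b (Suc i))\<^sup>2 else 0) \<le> \<phi> i - \<phi> (Suc i)" for i
    proof (cases "x \<le> b (Suc i)")
      case True
      have "x / 2 \<le> b i" using True b_ge[of i] p(2)[of i] by (simp add: b_Suc)
      then have "\<phi> i - \<phi> (Suc i) = x\<^sup>2 / b i - x\<^sup>2 / b (Suc i)"
        using p(1)[of i] by (simp add: \<phi>_def b_Suc max_def)
      also have "\<dots> = p i * x\<^sup>2 / (b i * b (Suc i))"
        using b_ge[of i] b_ge[of "Suc i"] by (simp add: field_simps) (simp add: b_Suc algebra_simps)
      also have "\<dots> \<ge> p i * x\<^sup>2 / (b (Suc i))\<^sup>2"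
        using b_ge[of i] b_ge[of "Suc i"] p(1)[of i]
        by (intro divide_left_mono) (auto simp: b_Suc power2_eq_square intro!: mult_right_mono)
      finally show ?thesis using True by simp
    next
      case False
      have "max (b i) (x / 2) \<le> max (b (Suc i)) (x / 2)" using p(1)[of i] by (simp add: b_Suc)
      then have "\<phi> (Suc i) \<le> \<phi> i" unfolding \<phi>_def
        using x by (intro divide_left_mono mult_pos_pos) (auto simp: less_max_iff_disj)
      with False show ?thesis by simp
    qed
    have "(\<Sum>i<n. if x \<le> b (Suc i) then p i * x\<^sup>2 / (b (Suc i))\<^sup>2 else 0) \<le> (\<Sum>i<n. \<phi> i - \<phi> (Suc i))"
      by (intro sum_mono \<phi>)
    also have "\<dots> = \<phi> 0 - \<phi> n" by (rule sum_lessThan_telescope')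
    also have "\<dots> \<le> \<phi> 0" using x by (simp add: \<phi>_def)
    also have "\<dots> \<le> x\<^sup>2 / (x / 2)" unfolding \<phi>_def using x
      by (intro divide_left_mono mult_pos_pos) (auto simp: less_max_iff_disj)
    also have "\<dots> = 2 * x" using x by (simp add: power2_eq_square)
    finally show ?thesis .
  qed (simp add: sum.neutral)
qed

section \<open>Second moments and almost sure convergence\<close>

context prob_space
begin

lemma expectation_square_sum_indep:
  fixes Z :: "'i \<Rightarrow> 'a \<Rightarrow> real"
  assumes I: "finite I" and indep: "indep_vars (\<lambda>_. borel) Z I"
    and int: "\<And>i. i \<in> I \<Longrightarrow> integrable M (\<lambda>\<omega>. (Z i \<omega>)\<^sup>2)"
    and mean: "\<And>i. i \<in> I \<Longrightarrow> expectation (Z i) = 0"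
  shows "integrable M (\<lambda>\<omega>. (\<Sum>i\<in>I. Z i \<omega>)\<^sup>2)"
    and "expectation (\<lambda>\<omega>. (\<Sum>i\<in>I. Z i \<omega>)\<^sup>2) = (\<Sum>i\<in>I. expectation (\<lambda>\<omega>. (Z i \<omega>)\<^sup>2))"
proof -
  have [measurable]: "Z i \<in> borel_measurable M" if "i \<in> I" for i
    using indep that unfolding indep_vars_def by blast
  have intZ: "integrable M (Z i)" if "i \<in> I" for i
    using that int[OF that] square_integrable_imp_integrable[of "Z i"] by simp
  have prod: "integrable M (\<lambda>\<omega>. Z i \<omega> * Z j \<omega>) \<and> expectation (\<lambda>\<omega>. Z i \<omega> * Z j \<omega>) = 0"
    if "i \<in> I" "j \<in> I" "i \<noteq> j" for i j
  proof -
    have "indep_vars (\<lambda>_. borel) Z {i, j}"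
      using indep_vars_subset[OF indep, of "{i, j}"] that by auto
    from indep_vars_lebesgue_integral[OF _ this] indep_vars_integrable[OF _ this]
    show ?thesis using that intZ mean by auto
  qed
  have eq: "(\<Sum>i\<in>I. Z i \<omega>)\<^sup>2 = (\<Sum>i\<in>I. \<Sum>j\<in>I. Z i \<omega> * Z j \<omega>)" for \<omega>
    by (simp add: power2_eq_square sum_product)
  have int_prod: "integrable M (\<lambda>\<omega>. Z i \<omega> * Z j \<omega>)" if "i \<in> I" "j \<in> I" for i j
    using prod[of i j] int[of i] that by (cases "i = j") (auto simp: power2_eq_square)
  show "integrable M (\<lambda>\<omega>. (\<Sum>i\<in>I. Z i \<omega>)\<^sup>2)"
    unfolding eq by (intro Bochner_Integration.integrable_sum int_prod)
  have "expectation (\<lambda>\<omega>. (\<Sum>i\<in>I. Z i \<omega>)\<^sup>2) = (\<Sum>i\<in>I. \<Sum>j\<in>I. expectation (\<lambda>\<omega>. Z i \<omega> * Z j \<omega>))"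
    unfolding eq by (simp add: Bochner_Integration.integral_sum int_prod)
  also have "\<dots> = (\<Sum>i\<in>I. \<Sum>j\<in>I. if i = j then expectation (\<lambda>\<omega>. (Z i \<omega>)\<^sup>2) else 0)"
    using prod by (intro sum.cong refl) (auto simp: power2_eq_square)
  finally show "expectation (\<lambda>\<omega>. (\<Sum>i\<in>I. Z i \<omega>)\<^sup>2) = (\<Sum>i\<in>I. expectation (\<lambda>\<omega>. (Z i \<omega>)\<^sup>2))"
    using I by simp
qed

end

text \<open>The sum of all squares has a finite integral by monotone convergence, so it is finite
  almost everywhere and its terms tend to 0.\<close>

lemma AE_tendsto_0_of_summable_second_moments:
  fixes Z :: "nat \<Rightarrow> 'a \<Rightarrow> real"
  assumes [measurable]: "\<And>k. Z k \<in> borel_measurable M"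
    and int: "\<And>k. integrable M (\<lambda>\<omega>. (Z k \<omega>)\<^sup>2)"
    and sm: "summable (\<lambda>k. \<integral>\<omega>. (Z k \<omega>)\<^sup>2 \<partial>M)"
  shows "AE \<omega> in M. (\<lambda>k. Z k \<omega>) \<longlonglongrightarrow> 0"
proof -
  have "(\<integral>\<^sup>+\<omega>. (\<Sum>k. ennreal ((Z k \<omega>)\<^sup>2)) \<partial>M) = (\<Sum>k. \<integral>\<^sup>+\<omega>. ennreal ((Z k \<omega>)\<^sup>2) \<partial>M)"
    by (intro nn_integral_suminf) simp
  also have "\<dots> = (\<Sum>k. ennreal (\<integral>\<omega>. (Z k \<omega>)\<^sup>2 \<partial>M))"
    using int by (simp add: nn_integral_eq_integral)
  also have "\<dots> \<noteq> \<infinity>" using sm by (simp add: ennreal_suminf_neq_top)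
  finally have "AE \<omega> in M. (\<Sum>k. ennreal ((Z k \<omega>)\<^sup>2)) \<noteq> \<infinity>"
    by (intro nn_integral_PInf_AE) auto
  then show ?thesis
  proof eventually_elim
    case (elim \<omega>)
    then have "summable (\<lambda>k. (Z k \<omega>)\<^sup>2)" by (intro summable_suminf_not_top) auto
    then have "(\<lambda>k. sqrt ((Z k \<omega>)\<^sup>2)) \<longlonglongrightarrow> sqrt 0"
      by (intro tendsto_real_sqrt summable_LIMSEQ_zero)
    then show ?case by (simp add: tendsto_rabs_zero_iff)
  qed
qed

section \<open>Strong laws with normalisation \<open>b\<close>\<close>

context prob_space
begin

text \<open>
  Etemadi's argument: second moments give convergence along indices at which \<open>b\<close> first exceeds
  \<open>\<alpha> ^ k\<close>, and monotonicity of the partial sums fills the gaps up to a factor \<open>\<alpha>\<close>.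
\<close>

proposition etemadi_strong_law:
  fixes X :: "nat \<Rightarrow> 'a \<Rightarrow> real" and b :: "nat \<Rightarrow> real"
  assumes indep: "indep_vars (\<lambda>_. borel) X UNIV"
    and nonneg: "\<And>i \<omega>. 0 \<le> X i \<omega>"
    and int: "\<And>i. integrable M (\<lambda>\<omega>. (X i \<omega>)\<^sup>2)"
    and b_mono: "mono b" and b_0: "b 0 = 1" and b_Suc: "\<And>n. b (Suc n) \<le> b n + 1"
    and b_lim: "filterlim b at_top sequentially"
    and sm: "summable (\<lambda>i. expectation (\<lambda>\<omega>. (X i \<omega>)\<^sup>2) / (b (Suc i))\<^sup>2)"
    and mean: "(\<lambda>n. (\<Sum>i<n. expectation (X i)) / b n) \<longlonglongrightarrow> m"
  shows "AE \<omega> in M. (\<lambda>n. (\<Sum>i<n. X i \<omega>) / b n) \<longlonglongrightarrow> m"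
proof -
  have [measurable]: "X i \<in> borel_measurable M" for i
    using indep unfolding indep_vars_def by blast
  have intX: "integrable M (X i)" for i by (rule square_integrable_imp_integrable[OF _ int]) simp
  have b_ge: "1 \<le> b n" for n using monoD[OF b_mono, of 0 n] b_0 by simp
  have ex: "\<exists>n. x \<le> b n" for x
    using b_lim unfolding filterlim_at_top by (metis eventually_sequentially order_refl)
  define Z where "Z i \<omega> = X i \<omega> - expectation (X i)" for i \<omega>
  define v where "v i = expectation (\<lambda>\<omega>. (X i \<omega>)\<^sup>2)" for i
  have [measurable]: "Z i \<in> borel_measurable M" for i by (simp add: Z_def[abs_def])
  have Z_indep: "indep_vars (\<lambda>_. borel) Z UNIV"
    unfolding Z_def[abs_def] by (rule indep_vars_compose2[OF indep]) auto
  have Z_int: "integrable M (\<lambda>\<omega>. (Z i \<omega>)\<^sup>2)" for i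
    unfolding Z_def power2_diff using int[of i] intX[of i] by simp
  have Z_mean: "expectation (Z i) = 0" for i
    unfolding Z_def using intX[of i] by (simp add: prob_space)
  have Z_var: "expectation (\<lambda>\<omega>. (Z i \<omega>)\<^sup>2) \<le> v i" for i
    unfolding Z_def v_def using variance_eq[OF intX int, of i] by simp
  have v_nonneg: "0 \<le> v i" for i unfolding v_def by simp
  \<comment> \<open>Convergence for one ratio \<open>al\<close>. The ratios
    \<open>1 + 1 / real (Suc j)\<close> used at the end are countably many, so one null set serves
    them all.\<close>
  have sub: "AE \<omega> in M. (\<lambda>k. (\<Sum>i<\<nu> k. X i \<omega>) / b (\<nu> k)) \<longlonglongrightarrow> m"
    if al: "1 < al" and \<nu>: "\<And>k. \<nu> k = (LEAST n. al ^ k \<le> b n)" for al :: real and \<nu> :: "nat \<Rightarrow> nat"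
  proof -
    have \<nu>_ge: "al ^ k \<le> b (\<nu> k)" for k unfolding \<nu> by (rule LeastI_ex[OF ex])
    \<comment> \<open>Before \<open>\<nu> k\<close> the value of \<open>b\<close> is below
      \<open>al ^ k\<close>, and one further step adds at most \<open>1 \<le> al ^ k\<close>; hence
      the factor 2.\<close>
    have \<nu>_less: "b (Suc i) \<le> 2 * al ^ k" if "i < \<nu> k" for i k
    proof -
      have "b i < al ^ k" using that not_less_Least unfolding \<nu> by (metis not_le)
      then show ?thesis using b_Suc[of i] one_le_power[of al k] al by linarith
    qed
    have \<nu>_mono: "\<nu> k \<le> \<nu> K" if "k \<le> K" for k K
    proof -
      have "al ^ k \<le> al ^ K" using that al by (intro power_increasing) auto
      then show ?thesis using \<nu>_ge[of K] by (subst \<nu>) (rule Least_le, simp)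
    qed
    have \<nu>_lim: "filterlim \<nu> at_top sequentially"
      unfolding filterlim_at_top
    proof
      fix N
      obtain k where k: "b N < al ^ k" using real_arch_pow[OF al] by blast
      have "N \<le> \<nu> K" if "k \<le> K" for K
      proof (rule ccontr)
        assume "\<not> N \<le> \<nu> K"
        then have "b (\<nu> K) \<le> b N" using monoD[OF b_mono] by simp
        moreover have "al ^ k \<le> al ^ K" using that al by (intro power_increasing) auto
        ultimately show False using \<nu>_ge[of K] k by simp
      qed
      then show "\<forall>\<^sub>F K in sequentially. N \<le> \<nu> K" by (auto simp: eventually_sequentially)
    qed
    \<comment> \<open>\<open>r ^ k\<close> equals \<open>1 / (al ^ k)\<^sup>2\<close>, which bounds
      the factor \<open>1 / (b (\<nu> k))\<^sup>2\<close> in the variance of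
      \<open>W k\<close>.\<close>
    define r where "r = (1 / al)\<^sup>2"
    have r: "0 < r" "r < 1" using al by (auto simp: r_def power_less_one_iff)
    define W where "W k \<omega> = (\<Sum>i<\<nu> k. Z i \<omega>) / b (\<nu> k)" for k \<omega>
    have [measurable]: "W k \<in> borel_measurable M" for k by (simp add: W_def[abs_def])
    have indep': "indep_vars (\<lambda>_. borel) Z {..<\<nu> k}" for k
      using indep_vars_subset[OF Z_indep] by simp
    note sq = expectation_square_sum_indep[OF _ indep' Z_int Z_mean, simplified]
    have W_int: "integrable M (\<lambda>\<omega>. (W k \<omega>)\<^sup>2)" for k
      unfolding W_def power_divide using sq(1) by simp
    have W_le: "expectation (\<lambda>\<omega>. (W k \<omega>)\<^sup>2) \<le> (\<Sum>i<\<nu> k. v i * r ^ k)" for k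
    proof -
      have "expectation (\<lambda>\<omega>. (W k \<omega>)\<^sup>2) = (\<Sum>i<\<nu> k. expectation (\<lambda>\<omega>. (Z i \<omega>)\<^sup>2)) / (b (\<nu> k))\<^sup>2"
        unfolding W_def power_divide using sq(2) by simp
      also have "\<dots> \<le> (\<Sum>i<\<nu> k. v i) / (al ^ k)\<^sup>2"
        using \<nu>_ge[of k] al by (intro frac_le sum_mono Z_var power_mono sum_nonneg v_nonneg) auto
      also have "\<dots> = (\<Sum>i<\<nu> k. v i * r ^ k)"
        by (simp add: r_def power_divide sum_distrib_right flip: power_mult) (simp add: mult.commute sum_divide_distrib)
      finally show ?thesis .
    qed
    \<comment> \<open>The order of summation is exchanged. The variable \<open>Z i\<close> enters
      only those \<open>W k\<close> with \<open>i < \<nu> k\<close>, and \<open>\<nu>_less\<close>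
      turns this into \<open>r ^ k \<le> 4 / (b (Suc i))\<^sup>2\<close>. The geometric sum over
      such \<open>k\<close> is of that same order, so \<open>sm\<close> gives a bound independent of
      \<open>K\<close>.\<close>
    have "(\<Sum>k<K. expectation (\<lambda>\<omega>. (W k \<omega>)\<^sup>2)) \<le> (\<Sum>i. v i / (b (Suc i))\<^sup>2) * (4 / (1 - r))" for K
    proof -
      have "(\<Sum>k<K. expectation (\<lambda>\<omega>. (W k \<omega>)\<^sup>2)) \<le> (\<Sum>k<K. \<Sum>i<\<nu> k. v i * r ^ k)"
        by (intro sum_mono W_le)
      also have "\<dots> \<le> (\<Sum>k<K. \<Sum>i<\<nu> K. v i * (if r ^ k \<le> 4 / (b (Suc i))\<^sup>2 then r ^ k else 0))"
      proof (intro sum_mono)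
        fix k assume "k \<in> {..<K}"
        have "r ^ k \<le> 4 / (b (Suc i))\<^sup>2" if "i < \<nu> k" for i
        proof -
          have "(b (Suc i))\<^sup>2 \<le> (2 * al ^ k)\<^sup>2"
            using \<nu>_less[OF that] b_ge[of "Suc i"] by (intro power_mono) auto
          then have "(b (Suc i))\<^sup>2 * r ^ k \<le> (2 * al ^ k)\<^sup>2 * r ^ k"
            using r by (intro mult_right_mono) auto
          also have "\<dots> = 4 * (al * (1 / al)) ^ (2 * k)"
            unfolding r_def power_mult_distrib by (simp flip: power_mult add: mult.commute)
          also have "\<dots> = 4" using al by simp
          finally show ?thesis using b_ge[of "Suc i"] by (simp add: field_simps)
        qed
        then have "(\<Sum>i<\<nu> k. v i * r ^ k)
            = (\<Sum>i<\<nu> k. v i * (if r ^ k \<le> 4 / (b (Suc i))\<^sup>2 then r ^ k else 0))"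
          by (intro sum.cong) auto
        also have "\<dots> \<le> (\<Sum>i<\<nu> K. v i * (if r ^ k \<le> 4 / (b (Suc i))\<^sup>2 then r ^ k else 0))"
          using \<nu>_mono[of k K] \<open>k \<in> {..<K}\<close> r v_nonneg by (intro sum_mono2) auto
        finally show "(\<Sum>i<\<nu> k. v i * r ^ k)
            \<le> (\<Sum>i<\<nu> K. v i * (if r ^ k \<le> 4 / (b (Suc i))\<^sup>2 then r ^ k else 0))" .
      qed
      also have "\<dots> = (\<Sum>i<\<nu> K. v i * (\<Sum>k<K. if r ^ k \<le> 4 / (b (Suc i))\<^sup>2 then r ^ k else 0))"
        by (subst sum.swap) (simp add: sum_distrib_left)
      also have "\<dots> \<le> (\<Sum>i<\<nu> K. v i * (4 / (b (Suc i))\<^sup>2 / (1 - r)))"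
        using r by (intro sum_mono mult_left_mono geometric_sum_le_inverse v_nonneg) auto
      also have "\<dots> = (\<Sum>i<\<nu> K. v i / (b (Suc i))\<^sup>2) * (4 / (1 - r))"
        unfolding sum_distrib_right by (intro sum.cong) auto
      also have "\<dots> \<le> (\<Sum>i. v i / (b (Suc i))\<^sup>2) * (4 / (1 - r))"
        using r sm v_nonneg by (intro mult_right_mono sum_le_suminf) (auto simp: v_def)
      finally show ?thesis .
    qed
    then have "summable (\<lambda>k. expectation (\<lambda>\<omega>. (W k \<omega>)\<^sup>2))"
      by (intro summableI_nonneg_bounded) auto
    from AE_tendsto_0_of_summable_second_moments[OF _ W_int this]
    have "AE \<omega> in M. (\<lambda>k. W k \<omega>) \<longlonglongrightarrow> 0" by simp
    then show ?thesis
    proof eventually_elim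
      case (elim \<omega>)
      from tendsto_add[OF this filterlim_compose[OF mean \<nu>_lim]]
      show ?case by (simp add: W_def Z_def sum_subtractf diff_divide_distrib)
    qed
  qed
  have "AE \<omega> in M. \<forall>j. (\<lambda>k. (\<Sum>i<(LEAST n. (1 + 1 / real (Suc j)) ^ k \<le> b n). X i \<omega>) /
                     b (LEAST n. (1 + 1 / real (Suc j)) ^ k \<le> b n)) \<longlonglongrightarrow> m"
    unfolding AE_all_countable by (intro allI sub) auto
  then show ?thesis
  proof eventually_elim
    case (elim \<omega>)
    show ?case
      by (rule tendsto_ratio_of_geometric_subsequences[OF _ _ b_mono b_0 b_Suc b_lim])
         (use elim nonneg in \<open>auto intro!: sum_nonneg monoI sum_mono2\<close>)
  qed
qed

text \<open>
  Here \<open>U i\<close> vanishes except on an event of probability \<open>p i\<close>, on which it is distributed like \<open>F\<close>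
  under \<open>N\<close>; the condition \<open>g 0 = 0\<close> in the law lets the test function ignore the complement.
  Truncating \<open>U i\<close> at \<open>b (Suc i)\<close>, rather than at \<open>i\<close>, is what makes all sums telescope.
\<close>

proposition strong_law_thinned:
  fixes U :: "nat \<Rightarrow> 'a \<Rightarrow> real" and p b :: "nat \<Rightarrow> real" and F :: "'b \<Rightarrow> real"
  assumes indep: "indep_vars (\<lambda>_. borel) U UNIV"
    and U_nonneg: "\<And>i \<omega>. 0 \<le> U i \<omega>"
    and p: "\<And>i. 0 \<le> p i" "\<And>i. p i \<le> 1"
    and F_nonneg: "\<And>y. 0 \<le> F y" and F_int: "integrable N F"
    and law: "\<And>i g. g \<in> borel_measurable borel \<Longrightarrow> g 0 = 0 \<Longrightarrow>
                (\<integral>\<^sup>+\<omega>. ennreal (g (U i \<omega>)) \<partial>M) = ennreal (p i) * (\<integral>\<^sup>+y. ennreal (g (F y)) \<partial>N)"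
    and b: "\<And>n. b n = 1 + (\<Sum>i<n. p i)"
    and b_lim: "filterlim b at_top sequentially"
  shows "AE \<omega> in M. (\<lambda>n. (\<Sum>i<n. U i \<omega>) / b n) \<longlonglongrightarrow> (\<integral>y. F y \<partial>N)"
proof -
  have [measurable]: "U i \<in> borel_measurable M" for i
    using indep unfolding indep_vars_def by blast
  have [measurable]: "F \<in> borel_measurable N" using F_int by simp
  have b_0: "b 0 = 1" and b_Suc: "b (Suc i) = b i + p i" for i by (simp_all add: b)
  have b_ge: "1 \<le> b n" for n using p by (simp add: b sum_nonneg)
  have b_mono: "mono b" using p by (auto intro!: monoI sum_mono2 simp: b)
  have b_inv: "(\<lambda>n. c / b n) \<longlonglongrightarrow> 0" for c
    by (intro tendsto_divide_0[OF tendsto_const] filterlim_at_top_imp_at_infinity b_lim)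
  note tr = truncation_sums[of p b, OF p b_0 b_Suc F_nonneg]
  have law': "has_bochner_integral M (\<lambda>\<omega>. g (U i \<omega>)) (p i * (\<integral>y. g (F y) \<partial>N))"
    if [measurable]: "g \<in> borel_measurable borel" and "g 0 = 0" and g: "\<And>x. 0 \<le> g x"
      and "integrable N (\<lambda>y. g (F y))" for g i
    using law[of g i] that p(1)[of i]
    by (intro has_bochner_integral_nn_integral)
      (auto simp: nn_integral_eq_integral ennreal_mult)
  define X where "X i \<omega> = (if U i \<omega> \<le> b (Suc i) then U i \<omega> else 0)" for i \<omega>
  have int1: "integrable N (\<lambda>y. if F y \<le> b (Suc i) then F y else 0)" for i
    by (rule Bochner_Integration.integrable_bound[OF F_int]) (auto simp: F_nonneg)
  have int2: "integrable N (\<lambda>y. if F y \<le> b (Suc i) then (F y)\<^sup>2 else 0)" for i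
    by (rule Bochner_Integration.integrable_bound[OF integrable_mult_right[OF F_int, of "b (Suc i)"]])
       (use F_nonneg in \<open>auto simp: power2_eq_square abs_mult intro!: mult_mono\<close>)
  have int3: "integrable N (\<lambda>y. of_bool (b (Suc i) < F y) :: real)" for i
    by (rule Bochner_Integration.integrable_bound[OF F_int])
       (use F_nonneg b_ge[of "Suc i"] in \<open>auto simp: of_bool_def\<close>)
  \<comment> \<open>\<open>max x 0\<close> makes the test function nonnegative everywhere, as
    \<open>law'\<close> demands; on the nonnegative values of \<open>U i\<close> and
    \<open>F\<close> it changes nothing.\<close>
  have X1: "has_bochner_integral M (X i) (p i * (\<integral>y. (if F y \<le> b (Suc i) then F y else 0) \<partial>N))" for i
    unfolding X_def
    using law'[of "\<lambda>x. if x \<le> b (Suc i) then max x 0 else 0" i] F_nonneg U_nonneg int1[of i]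
    by (simp add: max_absorb1 cong: if_cong)
  have X2: "has_bochner_integral M (\<lambda>\<omega>. (X i \<omega>)\<^sup>2)
      (p i * (\<integral>y. (if F y \<le> b (Suc i) then (F y)\<^sup>2 else 0) \<partial>N))" for i
    unfolding X_def if_distrib[of "\<lambda>x. x\<^sup>2"]
    using law'[of "\<lambda>x. if x \<le> b (Suc i) then x\<^sup>2 else 0" i] int2[of i]
    by (simp cong: if_cong)
  have X3: "prob {\<omega>\<in>space M. b (Suc i) < U i \<omega>} = p i * (\<integral>y. of_bool (b (Suc i) < F y) \<partial>N)" for i
  proof -
    have "has_bochner_integral M (\<lambda>\<omega>. of_bool (b (Suc i) < U i \<omega>))
        (p i * (\<integral>y. of_bool (b (Suc i) < F y) \<partial>N))"
      using law'[of "\<lambda>x. of_bool (b (Suc i) < x)" i] int3[of i] b_ge[of "Suc i"] by simp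
    then have "(\<integral>\<omega>. (of_bool (b (Suc i) < U i \<omega>) :: real) \<partial>M) = p i * (\<integral>y. of_bool (b (Suc i) < F y) \<partial>N)"
      by (rule has_bochner_integral_integral_eq)
    moreover have "(\<integral>\<omega>. (of_bool (b (Suc i) < U i \<omega>) :: real) \<partial>M)
        = (\<integral>\<omega>. (indicator {\<omega>\<in>space M. b (Suc i) < U i \<omega>} \<omega> :: real) \<partial>M)"
      by (intro Bochner_Integration.integral_cong) (auto simp: indicator_def)
    ultimately show ?thesis by simp
  qed
  have "AE \<omega> in M. (\<lambda>n. (\<Sum>i<n. X i \<omega>) / b n) \<longlonglongrightarrow> (\<integral>y. F y \<partial>N)"
  proof (rule etemadi_strong_law[OF _ _ _ b_mono b_0 _ b_lim])
    show "indep_vars (\<lambda>_. borel) X UNIV"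
      unfolding X_def[abs_def]
      by (rule indep_vars_compose2[OF indep, where Y="\<lambda>i x. if x \<le> b (Suc i) then x else 0"]) auto
    show "0 \<le> X i \<omega>" for i \<omega> using U_nonneg by (simp add: X_def)
    show "integrable M (\<lambda>\<omega>. (X i \<omega>)\<^sup>2)" for i using X2 by (rule integrable.intros)
    show "b (Suc n) \<le> b n + 1" for n using p by (simp add: b_Suc)
    \<comment> \<open>After exchanging sum and integral, the integrand at \<open>y\<close> is the
      second sum of \<open>truncation_sums\<close> with \<open>x = F y\<close>.\<close>
    have "(\<Sum>i<n. expectation (\<lambda>\<omega>. (X i \<omega>)\<^sup>2) / (b (Suc i))\<^sup>2) \<le> (\<integral>y. 2 * F y \<partial>N)" for n
    proof -
      have "(\<Sum>i<n. expectation (\<lambda>\<omega>. (X i \<omega>)\<^sup>2) / (b (Suc i))\<^sup>2)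
          = (\<Sum>i<n. (\<integral>y. p i / (b (Suc i))\<^sup>2 * (if F y \<le> b (Suc i) then (F y)\<^sup>2 else 0) \<partial>N))"
        by (simp add: has_bochner_integral_integral_eq[OF X2])
      also have "\<dots> = (\<integral>y. (\<Sum>i<n. p i / (b (Suc i))\<^sup>2 * (if F y \<le> b (Suc i) then (F y)\<^sup>2 else 0)) \<partial>N)"
        using int2 by (intro Bochner_Integration.integral_sum[symmetric]) auto
      also have "\<dots> \<le> (\<integral>y. 2 * F y \<partial>N)"
      proof (rule integral_mono)
        fix y
        show "(\<Sum>i<n. p i / (b (Suc i))\<^sup>2 * (if F y \<le> b (Suc i) then (F y)\<^sup>2 else 0)) \<le> 2 * F y"
          using tr(2)[of y n] by (simp add: if_distrib cong: if_cong)
      qed (use int2 F_int in auto)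
      finally show ?thesis .
    qed
    then show "summable (\<lambda>i. expectation (\<lambda>\<omega>. (X i \<omega>)\<^sup>2) / (b (Suc i))\<^sup>2)"
      by (intro summableI_nonneg_bounded) auto
    \<comment> \<open>\<open>D n y\<close> is the share of \<open>F y\<close> that truncation
      removes, averaged with weights \<open>p i / b n\<close>. In the bound
      \<open>min (F y) (b n)\<close> the entry \<open>b n\<close> gives the dominating function
      \<open>F\<close>, and the entry \<open>F y\<close> gives pointwise convergence to 0.\<close>
    define D where "D n y = F y * (\<Sum>i<n. if b (Suc i) < F y then p i else 0) / b n" for n y
    have D_bound: "norm (D n y) \<le> F y * min (F y) (b n) / b n" for n y
    proof -
      have "0 \<le> D n y"
        unfolding D_def using F_nonneg p b_ge[of n]
        by (intro divide_nonneg_nonneg mult_nonneg_nonneg sum_nonneg) auto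
      moreover have "D n y \<le> F y * min (F y) (b n) / b n"
        unfolding D_def using F_nonneg b_ge[of n] tr(1)[of y n]
        by (intro divide_right_mono mult_left_mono) auto
      ultimately show ?thesis by simp
    qed
    have D_le: "norm (D n y) \<le> F y" for n y
    proof -
      have "F y * min (F y) (b n) / b n \<le> F y * b n / b n"
        using F_nonneg b_ge[of n] by (intro divide_right_mono mult_left_mono) auto
      also have "\<dots> = F y" using b_ge[of n] by simp
      finally show ?thesis using D_bound[of n y] by simp
    qed
    have D_lim: "(\<lambda>n. D n y) \<longlonglongrightarrow> 0" for y
    proof (rule Lim_null_comparison[OF _ b_inv[of "F y * F y"]])
      have "F y * min (F y) (b n) / b n \<le> F y * F y / b n" for n
        using F_nonneg b_ge[of n] by (intro divide_right_mono mult_left_mono) auto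
      then show "\<forall>\<^sub>F n in sequentially. norm (D n y) \<le> F y * F y / b n"
        by (intro always_eventually allI order_trans[OF D_bound])
    qed
    have D_meas [measurable]: "D n \<in> borel_measurable N" for n
      unfolding D_def[abs_def] by measurable
    have int_D: "(\<lambda>n. (\<integral>y. D n y \<partial>N)) \<longlonglongrightarrow> (\<integral>y. 0 \<partial>N)"
      by (rule integral_dominated_convergence[where w=F]) (use F_int D_lim D_le in auto)
    have D_int: "integrable N (D n)" for n
      by (rule Bochner_Integration.integrable_bound[OF F_int]) (use D_le F_nonneg in auto)
    \<comment> \<open>The \<open>p i\<close> with \<open>i < n\<close> sum to
      \<open>b n - 1\<close>, not to \<open>b n\<close>; this causes the middle term, which vanishes
      in the limit.\<close>
    have "(\<Sum>i<n. expectation (X i)) / b n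
        = (\<integral>y. F y \<partial>N) - (\<integral>y. F y \<partial>N) / b n - (\<integral>y. D n y \<partial>N)" for n
    proof -
      have "(\<Sum>i<n. expectation (X i)) / b n
          = (\<Sum>i<n. (\<integral>y. p i / b n * (if F y \<le> b (Suc i) then F y else 0) \<partial>N))"
        by (simp add: has_bochner_integral_integral_eq[OF X1] sum_divide_distrib)
      also have "\<dots> = (\<integral>y. (\<Sum>i<n. p i / b n * (if F y \<le> b (Suc i) then F y else 0)) \<partial>N)"
        using int1 by (intro Bochner_Integration.integral_sum[symmetric]) auto
      also have "\<dots> = (\<integral>y. F y - F y / b n - D n y \<partial>N)"
      proof (intro Bochner_Integration.integral_cong refl)
        fix y
        have "(\<Sum>i<n. p i / b n * (if F y \<le> b (Suc i) then F y else 0))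
            = (\<Sum>i<n. F y / b n * p i - F y / b n * (if b (Suc i) < F y then p i else 0))"
          by (intro sum.cong) auto
        also have "\<dots> = F y / b n * (\<Sum>i<n. p i) - D n y"
        proof -
          have D_eq: "D n y = F y / b n * (\<Sum>i<n. if b (Suc i) < F y then p i else 0)"
            by (simp add: D_def)
          show ?thesis by (simp only: sum_subtractf D_eq sum_distrib_left)
        qed
        also have "\<dots> = F y / b n * (b n - 1) - D n y" by (simp add: b)
        also have "\<dots> = F y - F y / b n - D n y"
          using b_ge[of n] by (simp add: field_simps)
        finally show "(\<Sum>i<n. p i / b n * (if F y \<le> b (Suc i) then F y else 0))
            = F y - F y / b n - D n y" .
      qed
      also have "\<dots> = (\<integral>y. F y \<partial>N) - (\<integral>y. F y \<partial>N) / b n - (\<integral>y. D n y \<partial>N)"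
        using F_int D_int[of n] by simp
      finally show ?thesis .
    qed
    moreover have "(\<lambda>n. (\<integral>y. F y \<partial>N) - (\<integral>y. F y \<partial>N) / b n - (\<integral>y. D n y \<partial>N))
        \<longlonglongrightarrow> (\<integral>y. F y \<partial>N) - 0 - (\<integral>y. 0 \<partial>N)"
      by (intro tendsto_intros b_inv int_D)
    ultimately show "(\<lambda>n. (\<Sum>i<n. expectation (X i)) / b n) \<longlonglongrightarrow> (\<integral>y. F y \<partial>N)" by simp
  qed
  \<comment> \<open>Almost surely truncation changes only finitely many variables: by the first sum
    of \<open>truncation_sums\<close>, the probabilities of a change add up to at most the integral
    of \<open>F\<close>.\<close>
  moreover have "AE \<omega> in M. eventually (\<lambda>i. \<omega> \<in> space M - {\<omega>\<in>space M. b (Suc i) < U i \<omega>}) sequentially"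
  proof (rule borel_cantelli_AE1)
    have "(\<Sum>i<n. prob {\<omega>\<in>space M. b (Suc i) < U i \<omega>}) \<le> (\<integral>y. F y \<partial>N)" for n
    proof -
      have "(\<Sum>i<n. prob {\<omega>\<in>space M. b (Suc i) < U i \<omega>})
          = (\<integral>y. (\<Sum>i<n. p i * of_bool (b (Suc i) < F y)) \<partial>N)"
        unfolding X3 integral_mult_right_zero[symmetric]
        using int3 by (intro Bochner_Integration.integral_sum[symmetric] integrable_mult_right) auto
      also have "\<dots> \<le> (\<integral>y. F y \<partial>N)"
      proof (rule integral_mono)
        fix y
        have "(\<Sum>i<n. p i * of_bool (b (Suc i) < F y)) = (\<Sum>i<n. if b (Suc i) < F y then p i else 0)"
          by (intro sum.cong) auto
        then show "(\<Sum>i<n. p i * of_bool (b (Suc i) < F y)) \<le> F y"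
          using tr(1)[of y n] by simp
      qed (use int3 F_int in \<open>auto intro!: Bochner_Integration.integrable_sum integrable_mult_right simp del: sum_mult_of_bool_eq\<close>)
      finally show ?thesis .
    qed
    then show "summable (\<lambda>i. prob {\<omega>\<in>space M. b (Suc i) < U i \<omega>})"
      by (intro summableI_nonneg_bounded) auto
  qed (auto simp: emeasure_eq_measure)
  ultimately show ?thesis
  proof eventually_elim
    case (elim \<omega>)
    then obtain K where K: "\<And>i. K \<le> i \<Longrightarrow> U i \<omega> = X i \<omega>"
      unfolding eventually_sequentially X_def by fastforce
    \<comment> \<open>From \<open>K\<close> on the two sequences agree, so their partial sums differ
      by a constant, which \<open>b n\<close> outgrows.\<close>
    have "(\<lambda>n. (\<Sum>i<K. U i \<omega> - X i \<omega>) / b n + (\<Sum>i<n. X i \<omega>) / b n) \<longlonglongrightarrow> 0 + (\<integral>y. F y \<partial>N)"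
      by (intro tendsto_add b_inv elim)
    moreover have "\<forall>\<^sub>F n in sequentially.
        (\<Sum>i<K. U i \<omega> - X i \<omega>) / b n + (\<Sum>i<n. X i \<omega>) / b n = (\<Sum>i<n. U i \<omega>) / b n"
      using eventually_ge_at_top[of K]
    proof eventually_elim
      case (elim n)
      then have "(\<Sum>i<K. U i \<omega> - X i \<omega>) = (\<Sum>i<n. U i \<omega> - X i \<omega>)"
        using K by (intro sum.mono_neutral_left) auto
      then show ?case by (simp add: sum_subtractf diff_divide_distrib)
    qed
    ultimately show ?case by (simp add: tendsto_cong)
  qed
qed

end

section \<open>Visits to a group along one sample path\<close>

text \<open>Induction on \<open>n\<close>: at a visit the count rises by one, and
  \<open>Suc n\<close> is the least time with the new count because all earlier counts are at most
  the old one. The assumption selects the branch of \<open>group_index\<close> that is not the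
  default 1.\<close>

lemma sum_group_obs:
  fixes Ys :: "nat \<Rightarrow> 'w \<Rightarrow> 'a::real_vector"
  assumes "filterlim (\<lambda>n. group_count Ss s n \<omega>) at_top sequentially"
  shows "(\<Sum>j=1..group_count Ss s n \<omega>. group_obs Ys Ss s j \<omega>)
           = (\<Sum>i=1..n. of_bool (Ss i \<omega> = s) *\<^sub>R Ys i \<omega>)"
proof (induction n)
  case 0
  show ?case by (simp add: group_count_def)
next
  case (Suc n)
  show ?case
  proof (cases "Ss (Suc n) \<omega> = s")
    case True
    have Suc_count: "group_count Ss s (Suc n) \<omega> = Suc (group_count Ss s n \<omega>)"
      using True by (simp add: group_count_def)
    have "group_index Ss s (Suc (group_count Ss s n \<omega>)) \<omega> = Suc n"
      unfolding group_index_def if_P[OF assms]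
    proof (rule Least_equality)
      show "1 \<le> Suc n \<and> group_count Ss s (Suc n) \<omega> = Suc (group_count Ss s n \<omega>)"
        using Suc_count by simp
      fix k assume k: "1 \<le> k \<and> group_count Ss s k \<omega> = Suc (group_count Ss s n \<omega>)"
      show "Suc n \<le> k"
      proof (rule ccontr)
        assume "\<not> Suc n \<le> k"
        then have "group_count Ss s k \<omega> \<le> group_count Ss s n \<omega>"
          unfolding group_count_def by (intro sum_mono2) auto
        with k show False by simp
      qed
    qed
    then have "group_obs Ys Ss s (Suc (group_count Ss s n \<omega>)) \<omega> = Ys (Suc n) \<omega>"
      by (simp add: group_obs_def)
    with Suc.IH True show ?thesis by (simp add: Suc_count)
  next
    case False
    then have "group_count Ss s (Suc n) \<omega> = group_count Ss s n \<omega>"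
      by (simp add: group_count_def)
    with Suc.IH False show ?thesis by simp
  qed
qed

text \<open>Phrased as the negation of what the Borel-Cantelli lemma would give if the visit
  probabilities were summable.\<close>

lemma not_eventually_other_group:
  assumes "filterlim (\<lambda>n. group_count Ss s n \<omega>) at_top sequentially"
  shows "\<not> (\<forall>\<^sub>F i in sequentially. Ss (Suc i) \<omega> \<noteq> s)"
proof
  assume "\<forall>\<^sub>F i in sequentially. Ss (Suc i) \<omega> \<noteq> s"
  then obtain K where K: "\<And>i. K \<le> i \<Longrightarrow> Ss (Suc i) \<omega> \<noteq> s"
    by (auto simp: eventually_sequentially)
  have "group_count Ss s n \<omega> = group_count Ss s K \<omega>" if "K \<le> n" for n
    using that
  proof (induction n rule: dec_induct)
    case (step n)
    then show ?case using K[of n] by (simp add: group_count_def)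
  qed simp
  moreover have "\<forall>\<^sub>F n in sequentially. Suc (group_count Ss s K \<omega>) \<le> group_count Ss s n \<omega>"
    using assms by (simp add: filterlim_at_top)
  ultimately show False
    unfolding eventually_sequentially by (metis not_less_eq_eq nle_le)
qed

section \<open>Reindexing, conditional laws and divergence of the visit probabilities\<close>

context prob_space
begin

text \<open>The data are indexed from 1, the strong laws from 0. This lemma and the next carry
  independence along the shift \<open>Suc\<close>.\<close>

lemma indep_sets_reindex:
  assumes inj: "inj_on h I" and indep: "indep_sets F (h ` I)"
  shows "indep_sets (\<lambda>i. F (h i)) I"
proof (rule indep_setsI)
  show "F (h i) \<subseteq> events" if "i \<in> I" for i
    using indep that by (auto simp: indep_sets_def)
  fix A J assume J: "J \<noteq> {}" "J \<subseteq> I" "finite J" and A: "\<forall>j\<in>J. A j \<in> F (h j)"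
  have injJ: "inj_on h J" using inj J(2) by (rule inj_on_subset)
  define B where "B k = A (the_inv_into J h k)" for k
  have B: "B (h j) = A j" if "j \<in> J" for j
    using that injJ by (simp add: B_def the_inv_into_f_f)
  have "prob (\<Inter>k\<in>h ` J. B k) = (\<Prod>k\<in>h ` J. prob (B k))"
    using J A B by (intro indep_setsD[OF indep]) auto
  then show "prob (\<Inter>j\<in>J. A j) = (\<Prod>j\<in>J. prob (A j))"
    using B injJ by (simp add: prod.reindex cong: INF_cong_simp prod.cong_simp)
qed

lemma indep_vars_reindex:
  assumes "inj_on h I" "indep_vars M' X (h ` I)"
  shows "indep_vars (\<lambda>i. M' (h i)) (\<lambda>i. X (h i)) I"
  using assms indep_sets_reindex[of h I "\<lambda>i. {X i -` A \<inter> space M | A. A \<in> sets (M' i)}"]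
  unfolding indep_vars_def2 by auto

text \<open>A real-valued density gives access to the transfer rules for Bochner integrals of
  vector-valued functions.\<close>

lemma cond_measure_eq_density:
  assumes "prob {\<omega>\<in>space M. T \<omega> = s} > 0"
  shows "cond_measure M T s
           = density M (\<lambda>\<omega>. ennreal (indicator {\<omega>\<in>space M. T \<omega> = s} \<omega> / prob {\<omega>\<in>space M. T \<omega> = s}))"
  unfolding cond_measure_def uniform_measure_def
  using assms
  by (intro arg_cong[where f="density M"] ext) (auto simp: emeasure_eq_measure indicator_def simp flip: divide_ennreal)

text \<open>Multiplying by the probability of the group undoes the normalisation of the conditional
  law. If that probability is 0, then \<open>law\<close> says nothing about \<open>N\<close>, but
  both sides vanish.\<close>

lemma nn_integral_group:
  assumes [measurable]: "Y \<in> measurable M K" "{\<omega>\<in>space M. T \<omega> = s} \<in> events" "g \<in> borel_measurable K"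
    and law: "prob {\<omega>\<in>space M. T \<omega> = s} > 0 \<Longrightarrow> distr (cond_measure M T s) K Y = N"
  shows "(\<integral>\<^sup>+\<omega>. g (Y \<omega>) * of_bool (T \<omega> = s) \<partial>M)
           = ennreal (prob {\<omega>\<in>space M. T \<omega> = s}) * (\<integral>\<^sup>+y. g y \<partial>N)"
proof (cases "prob {\<omega>\<in>space M. T \<omega> = s} > 0")
  case True
  let ?A = "{\<omega>\<in>space M. T \<omega> = s}"
  have [measurable_cong]: "sets (cond_measure M T s) = sets M" by (simp add: cond_measure_def)
  have "(\<integral>\<^sup>+y. g y \<partial>N) = (\<integral>\<^sup>+\<omega>. g (Y \<omega>) \<partial>cond_measure M T s)"
    unfolding law[OF True, symmetric] by (intro nn_integral_distr) auto
  also have "\<dots> = (\<integral>\<^sup>+\<omega>. g (Y \<omega>) * indicator ?A \<omega> \<partial>M) / ennreal (prob ?A)"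
    unfolding cond_measure_def by (subst nn_integral_uniform_measure) (auto simp: emeasure_eq_measure)
  also have "(\<integral>\<^sup>+\<omega>. g (Y \<omega>) * indicator ?A \<omega> \<partial>M) = (\<integral>\<^sup>+\<omega>. g (Y \<omega>) * of_bool (T \<omega> = s) \<partial>M)"
    by (intro nn_integral_cong) (auto simp: indicator_def)
  finally show ?thesis
    using True by (simp add: ennreal_times_divide mult_divide_eq_ennreal mult.commute[of "ennreal _"])
next
  case False
  then have "{\<omega>\<in>space M. T \<omega> = s} \<in> null_sets M"
    using measure_nonneg[of M "{\<omega>\<in>space M. T \<omega> = s}"] assms(2) by (auto simp: null_sets_def emeasure_eq_measure)
  then have "AE \<omega> in M. T \<omega> \<noteq> s" using AE_not_in by force
  then have "(\<integral>\<^sup>+\<omega>. g (Y \<omega>) * of_bool (T \<omega> = s) \<partial>M) = (\<integral>\<^sup>+\<omega>. 0 \<partial>M)"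
    by (intro nn_integral_cong_AE) (auto elim: eventually_mono)
  with False measure_nonneg[of M "{\<omega>\<in>space M. T \<omega> = s}"] show ?thesis by simp
qed

text \<open>If the probabilities were summable, the first Borel-Cantelli lemma would allow only
  finitely many visits almost surely, against the divergence of the counts.\<close>

lemma filterlim_group_probabilities:
  assumes [measurable]: "\<And>i. 1 \<le> i \<Longrightarrow> {\<omega>\<in>space M. Ss i \<omega> = s} \<in> events"
    and "AE \<omega> in M. filterlim (\<lambda>n. group_count Ss s n \<omega>) at_top sequentially"
  shows "filterlim (\<lambda>n. 1 + (\<Sum>i<n. prob {\<omega>\<in>space M. Ss (Suc i) \<omega> = s})) at_top sequentially"
proof -
  let ?p = "\<lambda>i. prob {\<omega>\<in>space M. Ss (Suc i) \<omega> = s}"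
  have not_sm: "\<not> summable ?p"
  proof
    assume "summable ?p"
    then have "AE \<omega> in M. \<forall>\<^sub>F i in sequentially. \<omega> \<in> space M - {\<omega>\<in>space M. Ss (Suc i) \<omega> = s}"
      by (intro borel_cantelli_AE1) (auto simp: emeasure_eq_measure)
    with assms(2) AE_space have "AE \<omega> in M. False"
    proof eventually_elim
      case (elim \<omega>)
      then show ?case using not_eventually_other_group[of Ss s \<omega>] by simp
    qed
    then show False by simp
  qed
  show ?thesis
    unfolding filterlim_at_top
  proof
    fix C :: real
    have "\<exists>n. C - 1 < (\<Sum>i<n. ?p i)"
      using not_sm summableI_nonneg_bounded[of ?p "C - 1"] by (force simp: not_less)
    then obtain n where n: "C - 1 < (\<Sum>i<n. ?p i)" ..
    have "C \<le> 1 + (\<Sum>i<m. ?p i)" if "n \<le> m" for m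
      using sum_mono2[of "{..<m}" "{..<n}" ?p] that n by force
    then show "\<forall>\<^sub>F n in sequentially. C \<le> 1 + (\<Sum>i<n. ?p i)"
      by (auto simp: eventually_sequentially)
  qed
qed

section \<open>Strong law within one group\<close>

text \<open>An instance of \<open>strong_law_thinned\<close>: membership in the group is the
  thinning event, and \<open>f\<close> under \<open>N\<close> takes the place of \<open>F\<close>. A
  general \<open>f\<close> is kept because numerator and denominator of the group mean need
  different choices.\<close>

lemma strong_law_group_sums:
  fixes Ys :: "nat \<Rightarrow> 'a \<Rightarrow> 'b" and f :: "'b \<Rightarrow> real"
  assumes indep: "indep_vars (\<lambda>_. K \<Otimes>\<^sub>M count_space A) (\<lambda>i \<omega>. (Ys i \<omega>, Ss i \<omega>)) {1..}"
    and s: "s \<in> A"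
    and law: "\<And>i. 1 \<le> i \<Longrightarrow> prob {\<omega>\<in>space M. Ss i \<omega> = s} > 0 \<Longrightarrow>
                distr (cond_measure M (Ss i) s) K (Ys i) = N"
    and lim: "AE \<omega> in M. filterlim (\<lambda>n. group_count Ss s n \<omega>) at_top sequentially"
    and f [measurable]: "f \<in> borel_measurable K" and f_nonneg: "\<And>y. 0 \<le> f y" and f_int: "integrable N f"
  shows "AE \<omega> in M. (\<lambda>n. (\<Sum>i=1..n. of_bool (Ss i \<omega> = s) * f (Ys i \<omega>)) /
           (1 + (\<Sum>i<n. prob {\<omega>\<in>space M. Ss (Suc i) \<omega> = s}))) \<longlonglongrightarrow> (\<integral>y. f y \<partial>N)"
proof -
  have pair: "(\<lambda>\<omega>. (Ys i \<omega>, Ss i \<omega>)) \<in> measurable M (K \<Otimes>\<^sub>M count_space A)" if "1 \<le> i" for i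
    using indep that unfolding indep_vars_def by auto
  have Y_meas: "Ys i \<in> measurable M K" if "1 \<le> i" for i
    using measurable_compose[OF pair[OF that] measurable_fst] by simp
  have S_meas: "Ss i \<in> measurable M (count_space A)" if "1 \<le> i" for i
    using measurable_compose[OF pair[OF that] measurable_snd] by simp
  have ev: "{\<omega>\<in>space M. Ss i \<omega> = s} \<in> events" if "1 \<le> i" for i
    using measurable_sets[OF S_meas[OF that], of "{s}"] s
    by (simp add: vimage_def Int_def conj_commute)
  define U where "U i \<omega> = of_bool (Ss (Suc i) \<omega> = s) * f (Ys (Suc i) \<omega>)" for i \<omega>
  have "AE \<omega> in M. (\<lambda>n. (\<Sum>i<n. U i \<omega>) / (1 + (\<Sum>i<n. prob {\<omega>\<in>space M. Ss (Suc i) \<omega> = s})))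
          \<longlonglongrightarrow> (\<integral>y. f y \<partial>N)"
  proof (rule strong_law_thinned[OF _ _ _ _ f_nonneg f_int])
    have h: "(\<lambda>x. of_bool (snd x = s) * f (fst x)) \<in> borel_measurable (K \<Otimes>\<^sub>M count_space A)"
    proof -
      have "(\<lambda>t. of_bool (t = s) :: real) \<in> borel_measurable (count_space A)" by simp
      from measurable_compose[OF measurable_snd this]
      show ?thesis by (intro borel_measurable_times) auto
    qed
    have "range Suc = {1..}" by (auto simp: image_iff Suc_le_eq gr0_conv_Suc)
    then have "indep_vars (\<lambda>_. K \<Otimes>\<^sub>M count_space A) (\<lambda>i \<omega>. (Ys (Suc i) \<omega>, Ss (Suc i) \<omega>)) UNIV"
      using indep_vars_reindex[of Suc UNIV "\<lambda>_. K \<Otimes>\<^sub>M count_space A"] indep by simp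
    from indep_vars_compose2[OF this h]
    show "indep_vars (\<lambda>_. borel) U UNIV" by (simp add: U_def[abs_def])
    show "0 \<le> U i \<omega>" for i \<omega> using f_nonneg by (simp add: U_def)
    fix i and g :: "real \<Rightarrow> real" assume g [measurable]: "g \<in> borel_measurable borel" and g_0: "g 0 = 0"
    \<comment> \<open>Outside the group \<open>U i\<close> is 0, so \<open>g 0 = 0\<close> lets the
      indicator be pulled out of \<open>g\<close>, which is the form
      \<open>nn_integral_group\<close> handles.\<close>
    have "(\<integral>\<^sup>+\<omega>. ennreal (g (U i \<omega>)) \<partial>M)
        = (\<integral>\<^sup>+\<omega>. ennreal (g (f (Ys (Suc i) \<omega>))) * of_bool (Ss (Suc i) \<omega> = s) \<partial>M)"
      using g_0 by (intro nn_integral_cong) (auto simp: U_def of_bool_def)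
    also have "\<dots> = ennreal (prob {\<omega>\<in>space M. Ss (Suc i) \<omega> = s}) * (\<integral>\<^sup>+y. ennreal (g (f y)) \<partial>N)"
      using Y_meas ev by (intro nn_integral_group[where K=K] law) auto
    finally show "(\<integral>\<^sup>+\<omega>. ennreal (g (U i \<omega>)) \<partial>M)
        = ennreal (prob {\<omega>\<in>space M. Ss (Suc i) \<omega> = s}) * (\<integral>\<^sup>+y. ennreal (g (f y)) \<partial>N)" .
  qed (use filterlim_group_probabilities[OF ev lim] in auto)
  moreover have "(\<Sum>i<n. U i \<omega>) = (\<Sum>i=1..n. of_bool (Ss i \<omega> = s) * f (Ys i \<omega>))" for n \<omega>
    by (simp add: U_def sum.atLeast1_atMost_eq)
  ultimately show ?thesis by simp
qed

text \<open>Dominated convergence for the indicators of the deviation events.\<close>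

lemma AE_tendsto_imp_tendsto_in_prob:
  fixes X :: "nat \<Rightarrow> 'a \<Rightarrow> 'b::{second_countable_topology, metric_space}"
  assumes [measurable]: "\<And>n. X n \<in> borel_measurable M" and lim: "AE \<omega> in M. (\<lambda>n. X n \<omega>) \<longlonglongrightarrow> c"
  shows "tendsto_in_prob M X c"
  unfolding tendsto_in_prob_def
proof (intro allI impI)
  fix \<epsilon> :: real assume "0 < \<epsilon>"
  have "(\<lambda>n. \<integral>\<omega>. indicator {\<omega>\<in>space M. \<epsilon> < dist (X n \<omega>) c} \<omega> \<partial>M) \<longlonglongrightarrow> (\<integral>\<omega>. (0::real) \<partial>M)"
  proof (rule integral_dominated_convergence[where w="\<lambda>_. 1"])
    show "AE \<omega> in M. (\<lambda>n. indicator {\<omega>\<in>space M. \<epsilon> < dist (X n \<omega>) c} \<omega>) \<longlonglongrightarrow> (0::real)"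
      using lim
    proof eventually_elim
      case (elim \<omega>)
      from tendstoD[OF this \<open>0 < \<epsilon>\<close>]
      have "\<forall>\<^sub>F n in sequentially. indicator {\<omega>\<in>space M. \<epsilon> < dist (X n \<omega>) c} \<omega> = (0::real)"
        by eventually_elim simp
      then show ?case by (rule tendsto_eventually)
    qed
  qed (auto simp: indicator_def)
  then show "(\<lambda>n. prob {\<omega>\<in>space M. \<epsilon> < dist (X n \<omega>) c}) \<longlonglongrightarrow> 0" by simp
qed

proposition strong_law_group_mean:
  fixes Ys :: "nat \<Rightarrow> 'a \<Rightarrow> 'b::euclidean_space"
  assumes indep: "indep_vars (\<lambda>_. borel \<Otimes>\<^sub>M count_space A) (\<lambda>i \<omega>. (Ys i \<omega>, Ss i \<omega>)) {1..}"
    and s: "s \<in> A"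
    and law: "\<And>i. 1 \<le> i \<Longrightarrow> prob {\<omega>\<in>space M. Ss i \<omega> = s} > 0 \<Longrightarrow>
                distr (cond_measure M (Ss i) s) borel (Ys i) = N"
    and lim: "AE \<omega> in M. filterlim (\<lambda>n. group_count Ss s n \<omega>) at_top sequentially"
    and N: "prob_space N" and N_int: "integrable N (\<lambda>y. y)"
  shows "AE \<omega> in M. (\<lambda>n. (1 / real (group_count Ss s n \<omega>)) *\<^sub>R
           (\<Sum>i=1..n. of_bool (Ss i \<omega> = s) *\<^sub>R Ys i \<omega>)) \<longlonglongrightarrow> (\<integral>y. y \<partial>N)"
proof -
  interpret N: prob_space N by fact
  define b where "b n = 1 + (\<Sum>i<n. prob {\<omega>\<in>space M. Ss (Suc i) \<omega> = s})" for n
  have b: "b n > 0" for n by (simp add: b_def add_pos_nonneg sum_nonneg)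
  note sl = strong_law_group_sums[OF indep s law lim, folded b_def]
  \<comment> \<open>Three limits relative to the same \<open>b n\<close>: the count itself, then the
    positive and the negative parts of the finitely many coordinates.\<close>
  have "AE \<omega> in M. (\<lambda>n. (\<Sum>i=1..n. of_bool (Ss i \<omega> = s) * 1) / b n) \<longlonglongrightarrow> (\<integral>y. 1 \<partial>N)"
    by (rule sl[where f="\<lambda>_. 1"]) auto
  moreover have "AE \<omega> in M. \<forall>e\<in>Basis. (\<lambda>n. (\<Sum>i=1..n. of_bool (Ss i \<omega> = s) * max (Ys i \<omega> \<bullet> e) 0) / b n)
      \<longlonglongrightarrow> (\<integral>y. max (y \<bullet> e) 0 \<partial>N)"
    unfolding AE_ball_countable[OF countable_finite[OF finite_Basis]]
  proof
    fix e :: 'b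
    have "integrable N (\<lambda>y. max (y \<bullet> e) 0)" using N_int by (intro integrable_max) auto
    then show "AE \<omega> in M. (\<lambda>n. (\<Sum>i=1..n. of_bool (Ss i \<omega> = s) * max (Ys i \<omega> \<bullet> e) 0) / b n)
        \<longlonglongrightarrow> (\<integral>y. max (y \<bullet> e) 0 \<partial>N)"
      by (intro sl[where f="\<lambda>y. max (y \<bullet> e) 0"]) auto
  qed
  moreover have "AE \<omega> in M. \<forall>e\<in>Basis. (\<lambda>n. (\<Sum>i=1..n. of_bool (Ss i \<omega> = s) * max (- (Ys i \<omega> \<bullet> e)) 0) / b n)
      \<longlonglongrightarrow> (\<integral>y. max (- (y \<bullet> e)) 0 \<partial>N)"
    unfolding AE_ball_countable[OF countable_finite[OF finite_Basis]]
  proof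
    fix e :: 'b
    have "integrable N (\<lambda>y. max (- (y \<bullet> e)) 0)" using N_int by (intro integrable_max) auto
    then show "AE \<omega> in M. (\<lambda>n. (\<Sum>i=1..n. of_bool (Ss i \<omega> = s) * max (- (Ys i \<omega> \<bullet> e)) 0) / b n)
        \<longlonglongrightarrow> (\<integral>y. max (- (y \<bullet> e)) 0 \<partial>N)"
      by (intro sl[where f="\<lambda>y. max (- (y \<bullet> e)) 0"]) auto
  qed
  ultimately show ?thesis
  proof eventually_elim
    case (elim \<omega>)
    have count: "(\<lambda>n. real (group_count Ss s n \<omega>) / b n) \<longlonglongrightarrow> 1"
      using elim(1) by (simp add: group_count_def N.prob_space)
    show ?case
      unfolding tendsto_componentwise_iff[where l="\<integral>y. y \<partial>N"]
    proof
      fix e :: 'b assume e: "e \<in> Basis"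
      have pm: "max t 0 - max (- t) 0 = t" for t :: real by (simp add: max_def)
      have "(\<integral>y. max (y \<bullet> e) 0 \<partial>N) - (\<integral>y. max (- (y \<bullet> e)) 0 \<partial>N) = (\<integral>y. y \<bullet> e \<partial>N)"
        using N_int by (subst Bochner_Integration.integral_diff[symmetric]) (auto simp: pm intro!: integrable_max)
      then have int: "(\<integral>y. max (y \<bullet> e) 0 \<partial>N) - (\<integral>y. max (- (y \<bullet> e)) 0 \<partial>N) = (\<integral>y. y \<partial>N) \<bullet> e"
        using N_int by simp
      have "(\<lambda>n. (\<Sum>i=1..n. of_bool (Ss i \<omega> = s) * max (Ys i \<omega> \<bullet> e) 0) / b n
          - (\<Sum>i=1..n. of_bool (Ss i \<omega> = s) * max (- (Ys i \<omega> \<bullet> e)) 0) / b n) \<longlonglongrightarrow> (\<integral>y. y \<partial>N) \<bullet> e"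
        unfolding int[symmetric] using elim(2,3) e by (intro tendsto_diff) auto
      then have "(\<lambda>n. (\<Sum>i=1..n. of_bool (Ss i \<omega> = s) * (Ys i \<omega> \<bullet> e)) / b n) \<longlonglongrightarrow> (\<integral>y. y \<partial>N) \<bullet> e"
        by (simp add: pm flip: diff_divide_distrib sum_subtractf right_diff_distrib)
      from tendsto_divide[OF this count]
      have "(\<lambda>n. ((\<Sum>i=1..n. of_bool (Ss i \<omega> = s) * (Ys i \<omega> \<bullet> e)) / b n) / (real (group_count Ss s n \<omega>) / b n))
          \<longlonglongrightarrow> (\<integral>y. y \<partial>N) \<bullet> e" by simp
      \<comment> \<open>This holds for every \<open>n\<close>: the positive \<open>b n\<close>
        cancels, and if the group is still empty both sides are 0 because division by 0 gives
        0.\<close>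
      moreover have "((\<Sum>i=1..n. of_bool (Ss i \<omega> = s) * (Ys i \<omega> \<bullet> e)) / b n) / (real (group_count Ss s n \<omega>) / b n)
          = ((1 / real (group_count Ss s n \<omega>)) *\<^sub>R (\<Sum>i=1..n. of_bool (Ss i \<omega> = s) *\<^sub>R Ys i \<omega>)) \<bullet> e" for n
        using b[of n] by (simp add: inner_sum_left)
      ultimately show "(\<lambda>n. ((1 / real (group_count Ss s n \<omega>)) *\<^sub>R
          (\<Sum>i=1..n. of_bool (Ss i \<omega> = s) *\<^sub>R Ys i \<omega>)) \<bullet> e) \<longlonglongrightarrow> (\<integral>y. y \<partial>N) \<bullet> e" by (simp only:)
    qed
  qed
qed

section \<open>Expectation as a mixture over the groups\<close>

text \<open>The density of the conditional measure is the indicator divided by the probability of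
  the group, and scaling by that probability leaves the bare indicator. Summed over the groups, the
  last two conclusions give \<open>E(Y)\<close>.\<close>

lemma integral_cond_measure:
  fixes Y :: "'a \<Rightarrow> 'b::{banach, second_countable_topology}"
  assumes q: "prob {\<omega>\<in>space M. T \<omega> = s} > 0"
    and [measurable]: "{\<omega>\<in>space M. T \<omega> = s} \<in> events" "Y \<in> borel_measurable M"
    and fin: "(\<integral>\<^sup>+\<omega>. ennreal (norm (Y \<omega>)) \<partial>cond_measure M T s) < \<infinity>"
  shows "integrable (cond_measure M T s) Y"
    and "integrable M (\<lambda>\<omega>. of_bool (T \<omega> = s) *\<^sub>R Y \<omega>)"
    and "prob {\<omega>\<in>space M. T \<omega> = s} *\<^sub>R (\<integral>\<omega>. Y \<omega> \<partial>cond_measure M T s)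
           = (\<integral>\<omega>. of_bool (T \<omega> = s) *\<^sub>R Y \<omega> \<partial>M)"
proof -
  let ?A = "{\<omega>\<in>space M. T \<omega> = s}"
  have [measurable_cong]: "sets (cond_measure M T s) = sets M" by (simp add: cond_measure_def)
  show int: "integrable (cond_measure M T s) Y"
    using fin by (intro integrableI_bounded) measurable
  have eq: "prob ?A *\<^sub>R ((indicator ?A \<omega> / prob ?A) *\<^sub>R Y \<omega>) = of_bool (T \<omega> = s) *\<^sub>R Y \<omega>"
    if "\<omega> \<in> space M" for \<omega>
    using that q by (auto simp: indicator_def)
  have int': "integrable M (\<lambda>\<omega>. (indicator ?A \<omega> / prob ?A) *\<^sub>R Y \<omega>)"
    using int unfolding cond_measure_eq_density[OF q] by (subst (asm) integrable_density) auto
  then have "integrable M (\<lambda>\<omega>. prob ?A *\<^sub>R ((indicator ?A \<omega> / prob ?A) *\<^sub>R Y \<omega>))"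
    by (rule integrable_scaleR_right)
  also have "?this \<longleftrightarrow> integrable M (\<lambda>\<omega>. of_bool (T \<omega> = s) *\<^sub>R Y \<omega>)"
    by (intro Bochner_Integration.integrable_cong refl eq)
  finally show "integrable M (\<lambda>\<omega>. of_bool (T \<omega> = s) *\<^sub>R Y \<omega>)" .
  have "prob ?A *\<^sub>R (\<integral>\<omega>. Y \<omega> \<partial>cond_measure M T s)
      = prob ?A *\<^sub>R (\<integral>\<omega>. (indicator ?A \<omega> / prob ?A) *\<^sub>R Y \<omega> \<partial>M)"
    unfolding cond_measure_eq_density[OF q] by (subst integral_density) auto
  also have "\<dots> = (\<integral>\<omega>. prob ?A *\<^sub>R ((indicator ?A \<omega> / prob ?A) *\<^sub>R Y \<omega>) \<partial>M)"
    by (rule integral_scaleR_right[symmetric])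
  also have "\<dots> = (\<integral>\<omega>. of_bool (T \<omega> = s) *\<^sub>R Y \<omega> \<partial>M)"
    by (intro Bochner_Integration.integral_cong refl eq)
  finally show "prob ?A *\<^sub>R (\<integral>\<omega>. Y \<omega> \<partial>cond_measure M T s)
      = (\<integral>\<omega>. of_bool (T \<omega> = s) *\<^sub>R Y \<omega> \<partial>M)" .
qed

end

section \<open>Combining the groups with the random weights\<close>

theorem proposition3p1:
  fixes P :: "'w measure"
    and \<xi> :: nat
    and Y :: "'w \<Rightarrow> real ^ 'd"
    and S :: "'w \<Rightarrow> nat"
    and Ys :: "nat \<Rightarrow> 'w \<Rightarrow> real ^ 'd"
    and Ss :: "nat \<Rightarrow> 'w \<Rightarrow> nat"
    and lam :: "nat \<Rightarrow> nat \<Rightarrow> 'w \<Rightarrow> real"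
  assumes "prob_space P"
    and "\<xi> \<ge> 1"
    and "(\<lambda>\<omega>. (Y \<omega>, S \<omega>)) \<in> measurable P (borel \<Otimes>\<^sub>M count_space {1..\<xi>})"
    and "\<And>i. i \<ge> 1 \<Longrightarrow>
           (\<lambda>\<omega>. (Ys i \<omega>, Ss i \<omega>)) \<in> measurable P (borel \<Otimes>\<^sub>M count_space {1..\<xi>})"
    and "prob_space.indep_vars P (\<lambda>_. borel \<Otimes>\<^sub>M count_space {1..\<xi>})
           (\<lambda>i \<omega>. (Ys i \<omega>, Ss i \<omega>)) {1..}"
    and "\<And>i s. i \<ge> 1 \<Longrightarrow> s \<in> {1..\<xi>} \<Longrightarrow>
           measure P {\<omega> \<in> space P. Ss i \<omega> = s} * measure P {\<omega> \<in> space P. S \<omega> = s} > 0 \<Longrightarrow>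
           distr (cond_measure P (Ss i) s) borel (Ys i) = distr (cond_measure P S s) borel Y"
    and "\<And>s. s \<in> {1..\<xi>} \<Longrightarrow>
           AE \<omega> in P. filterlim (\<lambda>n. group_count Ss s n \<omega>) at_top sequentially"
    and "\<And>s. s \<in> {1..\<xi>} \<Longrightarrow> measure P {\<omega> \<in> space P. S \<omega> = s} > 0"
    and "\<And>s. s \<in> {1..\<xi>} \<Longrightarrow> (\<integral>\<^sup>+ \<omega>. ennreal (norm (Y \<omega>)) \<partial>cond_measure P S s) < \<infinity>"
    and "\<And>n s. n \<ge> 1 \<Longrightarrow> s \<in> {1..\<xi>} \<Longrightarrow> lam n s \<in> borel_measurable P"
    and "\<And>n s \<omega>. n \<ge> 1 \<Longrightarrow> s \<in> {1..\<xi>} \<Longrightarrow> \<omega> \<in> space P \<Longrightarrow> lam n s \<omega> \<in> {0..1}"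
    and "\<And>n \<omega>. n \<ge> 1 \<Longrightarrow> \<omega> \<in> space P \<Longrightarrow> (\<Sum>s=1..\<xi>. lam n s \<omega>) = 1"
  shows "((\<forall>s\<in>{1..\<xi>}. AE \<omega> in P.
             (\<lambda>n. lam n s \<omega>) \<longlonglongrightarrow> measure P {\<omega> \<in> space P. S \<omega> = s})
          \<longrightarrow> (AE \<omega> in P. (\<lambda>n. weighted_mean \<xi> lam Ys Ss n \<omega>) \<longlonglongrightarrow> (\<integral>\<omega>. Y \<omega> \<partial>P))) \<and>
         ((\<forall>s\<in>{1..\<xi>}. tendsto_in_prob P (\<lambda>n. lam n s) (measure P {\<omega> \<in> space P. S \<omega> = s}))
          \<longrightarrow> tendsto_in_prob P (weighted_mean \<xi> lam Ys Ss) (\<integral>\<omega>. Y \<omega> \<partial>P))"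
proof -
  note P_prob = assms(1) and YS_meas = assms(3) and YSi_meas = assms(4) and indep = assms(5)
    and law = assms(6) and count_lim = assms(7) and q_pos = assms(8) and Y_fin = assms(9)
    and lam_meas = assms(10) and lam_range = assms(11)
  interpret prob_space P by fact
  let ?G = "{1..\<xi>}"
  define q where "q s = prob {\<omega>\<in>space P. S \<omega> = s}" for s
  define N where "N s = distr (cond_measure P S s) borel Y" for s
  define m where "m s = (\<integral>y. y \<partial>N s)" for s
  \<comment> \<open>\<open>R\<close> expresses the group mean without \<open>group_index\<close>. By
    \<open>sum_group_obs\<close> the two agree wherever the counts diverge, and \<open>R\<close> is
    visibly measurable.\<close>
  define R where "R s n \<omega> = (1 / real (group_count Ss s n \<omega>)) *\<^sub>R
    (\<Sum>i=1..n. of_bool (Ss i \<omega> = s) *\<^sub>R Ys i \<omega>)" for s n \<omega>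
  have Y_meas [measurable]: "Y \<in> borel_measurable P"
    using measurable_compose[OF YS_meas measurable_fst] by simp
  have S_meas: "S \<in> measurable P (count_space ?G)"
    using measurable_compose[OF YS_meas measurable_snd] by simp
  have Ys_meas: "Ys i \<in> borel_measurable P" if "1 \<le> i" for i
    using measurable_compose[OF YSi_meas[OF that] measurable_fst] by simp
  have Ss_meas: "Ss i \<in> measurable P (count_space ?G)" if "1 \<le> i" for i
    using measurable_compose[OF YSi_meas[OF that] measurable_snd] by simp
  have ev: "{\<omega>\<in>space P. S \<omega> = s} \<in> events" if "s \<in> ?G" for s
    using measurable_sets[OF S_meas, of "{s}"] that by (simp add: vimage_def Int_def conj_commute)
  have of_bool_meas: "(\<lambda>\<omega>. of_bool (Ss i \<omega> = s) :: real) \<in> borel_measurable P" if "1 \<le> i" for i s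
    by (rule measurable_compose[OF Ss_meas[OF that]]) simp
  have cond: "prob_space (cond_measure P S s)" if "s \<in> ?G" for s
    unfolding cond_measure_def
    using q_pos[OF that] by (intro prob_space_uniform_measure) (auto simp: emeasure_eq_measure)
  have [measurable_cong]: "sets (cond_measure P S s) = sets P" for s by (simp add: cond_measure_def)
  have Q: "integrable (cond_measure P S s) Y"
      "integrable P (\<lambda>\<omega>. of_bool (S \<omega> = s) *\<^sub>R Y \<omega>)"
      "q s *\<^sub>R (\<integral>\<omega>. Y \<omega> \<partial>cond_measure P S s) = (\<integral>\<omega>. of_bool (S \<omega> = s) *\<^sub>R Y \<omega> \<partial>P)"
    if "s \<in> ?G" for s
    using integral_cond_measure[OF q_pos[OF that] ev[OF that] Y_meas Y_fin[OF that]]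
    by (simp_all add: q_def)
  have m: "m s = (\<integral>\<omega>. Y \<omega> \<partial>cond_measure P S s)" if "s \<in> ?G" for s
    unfolding m_def N_def by (rule integral_distr) auto
  have R_lim: "AE \<omega> in P. (\<lambda>n. R s n \<omega>) \<longlonglongrightarrow> m s" if s: "s \<in> ?G" for s
    unfolding R_def m_def
  proof (rule strong_law_group_mean[OF indep s _ count_lim[OF s]])
    \<comment> \<open>Hypothesis (ii) asks for a positive product of probabilities;
      \<open>q_pos\<close> supplies the factor for \<open>S\<close>.\<close>
    show "distr (cond_measure P (Ss i) s) borel (Ys i) = N s"
      if "1 \<le> i" "prob {\<omega>\<in>space P. Ss i \<omega> = s} > 0" for i
      unfolding N_def using that q_pos[OF s] by (intro law[OF _ s]) auto
    show "prob_space (N s)"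
      unfolding N_def using cond[OF s] by (rule prob_space.prob_space_distr) simp
    show "integrable (N s) (\<lambda>y. y)"
      unfolding N_def using Q(1)[OF s] by (subst integrable_distr_eq) auto
  qed
  have R_meas: "R s n \<in> borel_measurable P" for s n
  proof -
    have "(\<lambda>\<omega>. real (group_count Ss s n \<omega>)) \<in> borel_measurable P"
      unfolding group_count_def of_nat_sum of_nat_of_bool
      by (intro borel_measurable_sum of_bool_meas) auto
    moreover have "(\<lambda>\<omega>. \<Sum>i=1..n. of_bool (Ss i \<omega> = s) *\<^sub>R Ys i \<omega>) \<in> borel_measurable P"
      by (intro borel_measurable_sum borel_measurable_scaleR of_bool_meas Ys_meas) auto
    ultimately show ?thesis unfolding R_def[abs_def] by measurable
  qed
  have mean: "(\<integral>\<omega>. Y \<omega> \<partial>P) = (\<Sum>s\<in>?G. q s *\<^sub>R m s)"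
  proof -
    \<comment> \<open>Every label \<open>S \<omega>\<close> lies in \<open>?G\<close>, so exactly
      one of the indicators is 1 at each point.\<close>
    have "(\<integral>\<omega>. Y \<omega> \<partial>P) = (\<integral>\<omega>. (\<Sum>s\<in>?G. of_bool (S \<omega> = s) *\<^sub>R Y \<omega>) \<partial>P)"
    proof (intro Bochner_Integration.integral_cong refl)
      fix \<omega> assume "\<omega> \<in> space P"
      then have "S \<omega> \<in> ?G" using measurable_space[OF S_meas] by simp
      then show "Y \<omega> = (\<Sum>s\<in>?G. of_bool (S \<omega> = s) *\<^sub>R Y \<omega>)"
        by (subst sum.remove[of _ "S \<omega>"]) auto
    qed
    also have "\<dots> = (\<Sum>s\<in>?G. (\<integral>\<omega>. of_bool (S \<omega> = s) *\<^sub>R Y \<omega> \<partial>P))"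
      by (intro Bochner_Integration.integral_sum Q)
    also have "\<dots> = (\<Sum>s\<in>?G. q s *\<^sub>R m s)" using Q(3) m by (intro sum.cong) auto
    finally show ?thesis .
  qed
  have weighted: "AE \<omega> in P. \<forall>n. weighted_mean \<xi> lam Ys Ss n \<omega> = (\<Sum>s\<in>?G. lam n s \<omega> *\<^sub>R R s n \<omega>)"
  proof -
    have "AE \<omega> in P. \<forall>s\<in>?G. filterlim (\<lambda>n. group_count Ss s n \<omega>) at_top sequentially"
      using count_lim by (intro AE_finite_allI) auto
    then show ?thesis
    proof eventually_elim
      case (elim \<omega>)
      show ?case
        unfolding weighted_mean_def group_mean_def R_def
        by (intro allI sum.cong refl, subst sum_group_obs) (use elim in auto)
    qed
  qed
  show ?thesis
  proof (intro conjI impI)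
    assume lam: "\<forall>s\<in>?G. AE \<omega> in P. (\<lambda>n. lam n s \<omega>) \<longlonglongrightarrow> prob {\<omega>\<in>space P. S \<omega> = s}"
    have "AE \<omega> in P. \<forall>s\<in>?G. (\<lambda>n. lam n s \<omega>) \<longlonglongrightarrow> q s"
      using lam by (intro AE_finite_allI) (auto simp: q_def)
    moreover have "AE \<omega> in P. \<forall>s\<in>?G. (\<lambda>n. R s n \<omega>) \<longlonglongrightarrow> m s"
      using R_lim by (intro AE_finite_allI) auto
    ultimately show "AE \<omega> in P. (\<lambda>n. weighted_mean \<xi> lam Ys Ss n \<omega>) \<longlonglongrightarrow> (\<integral>\<omega>. Y \<omega> \<partial>P)"
      using weighted
    proof eventually_elim
      case (elim \<omega>)
      then show ?case unfolding mean by (auto intro!: tendsto_sum tendsto_scaleR)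
    qed
  next
    assume lam: "\<forall>s\<in>?G. tendsto_in_prob P (\<lambda>n. lam n s) (prob {\<omega>\<in>space P. S \<omega> = s})"
    show "tendsto_in_prob P (weighted_mean \<xi> lam Ys Ss) (\<integral>\<omega>. Y \<omega> \<partial>P)"
      unfolding tendsto_in_prob_def
    proof (intro allI impI)
      fix \<epsilon> :: real assume "0 < \<epsilon>"
      \<comment> \<open>Each of the \<open>\<xi>\<close> groups may contribute
        \<open>2 * \<delta>\<close>: one \<open>\<delta>\<close> for the error of its mean and one
        for the error of its weight. The \<open>+ 1\<close> in \<open>\<eta>\<close> below covers
        \<open>m s = 0\<close>.\<close>
      define \<delta> where "\<delta> = \<epsilon> / (2 * real \<xi>)"
      have \<delta>: "0 < \<delta>" "real \<xi> * (2 * \<delta>) = \<epsilon>" using \<open>0 < \<epsilon>\<close> assms(2) by (auto simp: \<delta>_def)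
      define \<eta> where "\<eta> s = \<delta> / (norm (m s) + 1)" for s
      have \<eta>: "0 < \<eta> s" "\<eta> s * norm (m s) \<le> \<delta>" for s
      proof -
        have "0 < norm (m s) + 1" using norm_ge_zero[of "m s"] by linarith
        then show "0 < \<eta> s" "\<eta> s * norm (m s) \<le> \<delta>" using \<delta> by (simp_all add: \<eta>_def field_simps)
      qed
      define A where "A s n = {\<omega>\<in>space P. \<delta> < dist (R s n \<omega>) (m s)}" for s n
      define B where "B s n = {\<omega>\<in>space P. \<eta> s < dist (lam n s \<omega>) (q s)}" for s n
      have A_ev: "A s n \<in> events" for s n
        using R_meas[of s n] unfolding A_def by measurable
      have B_ev: "B s n \<in> events" if "1 \<le> n" "s \<in> ?G" for s n
        using lam_meas[OF that] unfolding B_def by measurable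
      have "(\<lambda>n. \<Sum>s\<in>?G. prob (A s n) + prob (B s n)) \<longlonglongrightarrow> (\<Sum>s\<in>?G. 0 + 0)"
      proof (intro tendsto_sum tendsto_add)
        fix s assume s: "s \<in> ?G"
        show "(\<lambda>n. prob (A s n)) \<longlonglongrightarrow> 0"
          using AE_tendsto_imp_tendsto_in_prob[OF R_meas R_lim[OF s]] \<delta>(1)
          by (simp add: tendsto_in_prob_def A_def)
        show "(\<lambda>n. prob (B s n)) \<longlonglongrightarrow> 0"
          using lam s \<eta>(1)[of s] by (simp add: tendsto_in_prob_def B_def q_def)
      qed
      then have lim: "(\<lambda>n. \<Sum>s\<in>?G. prob (A s n) + prob (B s n)) \<longlonglongrightarrow> 0" by simp
      let ?E = "\<lambda>n. {\<omega>\<in>space P. \<epsilon> < dist (weighted_mean \<xi> lam Ys Ss n \<omega>) (\<integral>\<omega>. Y \<omega> \<partial>P)}"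
      \<comment> \<open>The weights are known to be measurable and to lie in the unit interval only
        from \<open>n = 1\<close> on; the limit does not see \<open>n = 0\<close>.\<close>
      have bound: "prob (?E n) \<le> (\<Sum>s\<in>?G. prob (A s n) + prob (B s n))" if n: "1 \<le> n" for n
      proof -
        have AB: "A s n \<union> B s n \<in> events" if "s \<in> ?G" for s using A_ev B_ev[OF n that] by auto
        have "AE \<omega> in P. \<omega> \<in> ?E n \<longrightarrow> \<omega> \<in> (\<Union>s\<in>?G. A s n \<union> B s n)"
          using weighted
        proof eventually_elim
          case (elim \<omega>)
          show ?case
          proof (rule impI, rule ccontr)
            assume E: "\<omega> \<in> ?E n" and "\<omega> \<notin> (\<Union>s\<in>?G. A s n \<union> B s n)"
            then have small: "norm (R s n \<omega> - m s) \<le> \<delta>" "\<bar>lam n s \<omega> - q s\<bar> \<le> \<eta> s" if "s \<in> ?G" for s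
              using that by (auto simp: A_def B_def dist_norm not_less)
            \<comment> \<open>In this splitting the error of \<open>R\<close> carries the weight,
              which is at most 1, and the error of the weight carries the fixed vector
              \<open>m s\<close>. Both are bounded pointwise, so the joint law of weights and data
              does not enter.\<close>
            have "weighted_mean \<xi> lam Ys Ss n \<omega> - (\<integral>\<omega>. Y \<omega> \<partial>P)
                = (\<Sum>s\<in>?G. lam n s \<omega> *\<^sub>R (R s n \<omega> - m s) + (lam n s \<omega> - q s) *\<^sub>R m s)"
              unfolding mean using elim by (simp add: algebra_simps sum_subtractf)
            also have "norm \<dots> \<le> (\<Sum>s\<in>?G. 2 * \<delta>)"
            proof (rule sum_norm_le)
              fix s assume s: "s \<in> ?G"
              have "norm (lam n s \<omega> *\<^sub>R (R s n \<omega> - m s)) \<le> 1 * \<delta>"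
                using lam_range[OF n s] E small(1)[OF s] unfolding norm_scaleR
                by (intro mult_mono) auto
              moreover have "norm ((lam n s \<omega> - q s) *\<^sub>R m s) \<le> \<eta> s * norm (m s)"
                using small(2)[OF s] unfolding norm_scaleR by (intro mult_right_mono) auto
              ultimately show "norm (lam n s \<omega> *\<^sub>R (R s n \<omega> - m s) + (lam n s \<omega> - q s) *\<^sub>R m s) \<le> 2 * \<delta>"
                using \<eta>(2)[of s] by (intro order_trans[OF norm_triangle_ineq]) simp
            qed
            also have "\<dots> = \<epsilon>" using \<delta>(2) by simp
            finally show False using E by (simp add: dist_norm)
          qed
        qed
        then have "prob (?E n) \<le> prob (\<Union>s\<in>?G. A s n \<union> B s n)"
          using AB by (intro finite_measure_mono_AE) auto
        also have "\<dots> \<le> (\<Sum>s\<in>?G. prob (A s n \<union> B s n))"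
          using AB by (intro finite_measure_subadditive_finite) auto
        also have "\<dots> \<le> (\<Sum>s\<in>?G. prob (A s n) + prob (B s n))"
          using A_ev B_ev[OF n] by (intro sum_mono measure_Un_le) auto
        finally show ?thesis .
      qed
      show "(\<lambda>n. prob (?E n)) \<longlonglongrightarrow> 0"
        by (rule tendsto_sandwich[OF _ _ tendsto_const lim])
           (use bound in \<open>auto intro: eventually_sequentiallyI[of 1]\<close>)
    qed
  qed
qed

end
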